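(* Let $a_1,a_2>0$. In each item, $t=(t_1,t_2,\dots)$ is a random vector with positive coordinates and $p=(p_1,p_2,\dots)$ is defined algebraically from $t$. Associated to every rank $2$ root system, the following identities in law hold. (Type $A_2$; $w_0=s_1s_2s_1=s_2s_1s_2$, $\mathbf i=(1,2,1)$, $\mathbf i'=(2,1,2)$) Let $p_1=\frac{t_2t_3}{t_1+t_3}$, $p_2=t_1+t_3$, $p_3=\frac{t_1t_2}{t_1+t_3}$. Then $$(t_1,t_2,t_3)\stackrel{\mathcal L}{=}(\gamma_{a_1},\gamma_{a_1+a_2},\gamma_{a_2})\iff(p_1,p_2,p_3)\stackrel{\mathcal L}{=}(\gamma_{a_2},\gamma_{a_1+a_2},\gamma_{a_1}).$$ (Type $B_2$; $w_0=s_1s_2s_1s_2=s_2s_1s_2s_1$, $\mathbf i=(1,2,1,2)$, $\mathbf i'=(2,1,2,1)$) Let $p_1=\frac{t_2t_3^2t_4}{\pi_2}$, $p_2=\frac{\pi_2}{\pi_1}$, $p_3=\frac{\pi_1^2}{\pi_2}$, $p_4=\frac{t_1t_2t_3}{\pi_1}$, where $\pi_1=t_1t_2+(t_1+t_3)t_4$ and $\pi_2=t_1^2t_2+(t_1+t_3)^2t_4$. Then $$(t_1,t_2,t_3,t_4)\stackrel{\mathcal L}{=}(\gamma_{a_1},\gamma_{a_1+a_2},\gamma_{a_1+2a_2},\gamma_{a_2})\iff(p_1,p_2,p_3,p_4)\stackrel{\mathcal L}{=}(\gamma_{a_2},\gamma_{a_1+2a_2},\gamma_{a_1+a_2},\gamma_{a_1}).$$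 (Type $C_2$; $w_0=s_1s_2s_1s_2=s_2s_1s_2s_1$, $\mathbf i=(1,2,1,2)$, $\mathbf i'=(2,1,2,1)$) Let $p_1=\frac{t_2t_3t_4}{\pi_1}$, $p_2=\frac{\pi_1^2}{\pi_2}$, $p_3=\frac{\pi_2}{\pi_1}$, $p_4=\frac{t_1t_2^2t_3}{\pi_2}$, where $\pi_1=t_1t_2+(t_1+t_3)t_4$ and $\pi_2=t_3t_4^2+(t_2+t_4)^2t_1$. Then $$(t_1,t_2,t_3,t_4)\stackrel{\mathcal L}{=}(\gamma_{a_1},\gamma_{2a_1+a_2},\gamma_{a_1+a_2},\gamma_{a_2})\iff(p_1,p_2,p_3,p_4)\stackrel{\mathcal L}{=}(\gamma_{a_2},\gamma_{a_1+a_2},\gamma_{2a_1+a_2},\gamma_{a_1}).$$ (Type $G_2$; $w_0=s_1s_2s_1s_2s_1s_2=s_2s_1s_2s_1s_2s_1$, $\mathbf i=(1,2,1,2,1,2)$, $\mathbf i'=(2,1,2,1,2,1)$) Let $$p_1=\frac{t_2t_3^3t_4^2t_5^3t_6}{\pi_3},\quad p_2=\frac{\pi_3}{\pi_2},\quad p_3=\frac{\pi_2^3}{\pi_3\pi_4},\quad p_4=\frac{\pi_4}{\pi_1\pi_2},\quad p_5=\frac{\pi_1^3}{\pi_4},\quad p_6=\frac{t_1t_2t_3^2t_4t_5}{\pi_1},$$ where $$\pi_1=t_1t_2t_3^2t_4+t_1t_2(t_3+t_5)^2t_6+(t_1+t_3)t_4t_5^2t_6,$$ $$\pi_2=t_1^2t_2^2t_3^3t_4+t_1^2t_2^2(t_3+t_5)^3t_6+(t_1+t_3)^2t_4^2t_5^3t_6+t_1t_2t_4t_5^2t_6(3t_1t_3+2t_3^2+2t_3t_5+2t_1t_5),$$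 $$\pi_3=t_1^3t_2^2t_3^3t_4+t_1^3t_2^2(t_3+t_5)^3t_6+(t_1+t_3)^3t_4^2t_5^3t_6+t_1^2t_2t_4t_5^2t_6(3t_1t_3+3t_3^2+3t_3t_5+2t_1t_5),$$ $$\pi_4=t_1^2t_2^2t_3^3t_4\big(t_1t_2t_3^3t_4+2t_1t_2(t_3+t_5)^3t_6+(3t_1t_3+3t_3^2+3t_3t_5+2t_1t_5)t_4t_5^2t_6\big)+t_6^2\big(t_1t_2(t_3+t_5)^2+(t_1+t_3)t_4t_5^2\big)^3.$$ Then $$(t_1,\dots,t_6)\stackrel{\mathcal L}{=}(\gamma_{a_1},\gamma_{3a_1+a_2},\gamma_{2a_1+a_2},\gamma_{3a_1+2a_2},\gamma_{a_1+a_2},\gamma_{a_2})$$ $$\iff(p_1,\dots,p_6)\stackrel{\mathcal L}{=}(\gamma_{a_2},\gamma_{a_1+a_2},\gamma_{3a_1+2a_2},\gamma_{2a_1+a_2},\gamma_{3a_1+a_2},\gamma_{a_1}).$$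
   Context: $\stackrel{\mathcal L}{=}$ denotes equality in law. For $a>0$, $\gamma_a$ denotes a gamma random variable with density $\frac1{\Gamma(a)}x^{a-1}e^{-x}$ on $\mathbb R_+$; within each vector $(\gamma_{\cdot},\gamma_{\cdot},\dots)$ the gamma variables are independent. In each item, $s_1,s_2$ are the simple reflections generating the Weyl group of the rank $2$ root system, $w_0$ is its longest element, and $\mathbf i,\mathbf i'$ are the two reduced words of $w_0$. The map $t\mapsto p$ is the change of Lusztig parameters from $\mathbf i$ to $\mathbf i'$, i.e. $x_1(t_1)x_2(t_2)x_1(t_3)\cdots=x_2(p_1)x_1(p_2)x_2(p_3)\cdots$, where $x_1,x_2$ are the one-parameter subgroups $x_i(t)=\exp(te_i)$ attached to the simple root vectors $e_1,e_2$.
   Formalization: In type G2 the printed gamma parameters do not fit the printed map and the claim fails for all a1,a2>0; the laws are corrected to t ~ (a1, a1+a2, 2a1+3a2, a1+2a2, a1+3a2, a2) and p ~ (a2, a1+3a2, a1+2a2, 2a1+3a2, a1+a2, a1). *)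

theory Defs
  imports "HOL-Probability.Probability"
begin

definition gamma_density :: "real \<Rightarrow> real \<Rightarrow> real" where
  "gamma_density a x = (if 0 < x then x powr (a - 1) * exp (- x) / Gamma a else 0)"

definition gamma_law :: "real \<Rightarrow> real measure" where
  "gamma_law a = density lborel (\<lambda>x. ennreal (gamma_density a x))"

lemma prob_space_gamma_law:
  assumes "0 < a"
  shows "prob_space (gamma_law a)"
proof
  have "emeasure (gamma_law a) (space (gamma_law a)) = (\<integral>\<^sup>+x. ennreal (gamma_density a x) \<partial>lborel)"
    unfolding gamma_law_def gamma_density_def by (subst emeasure_density) auto
  also have "\<dots> = (\<integral>\<^sup>+x. ennreal (1 / Gamma a) * ennreal (indicator {0..} x * x powr (a - 1) / exp x) \<partial>lborel)"
    using AE_lborel_singleton[of "0::real"] Gamma_real_pos[OF assms]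
    by (intro nn_integral_cong_AE)
       (auto simp: gamma_density_def exp_minus field_simps indicator_def simp flip: ennreal_mult')
  also have "\<dots> = ennreal (1 / Gamma a) * ennreal (Gamma a)"
    using Gamma_conv_nn_integral_real[OF assms] by (subst nn_integral_cmult) auto
  also have "\<dots> = 1"
    using Gamma_real_pos[OF assms] by (simp flip: ennreal_mult')
  finally show "emeasure (gamma_law a) (space (gamma_law a)) = 1" .
qed

definition pos_rv :: "'a measure \<Rightarrow> ('a \<Rightarrow> real) \<Rightarrow> bool" where
  "pos_rv M X \<longleftrightarrow> X \<in> borel_measurable M \<and> (AE \<omega> in M. 0 < X \<omega>)"

text \<open>
  Below, \<open>x\<^sub>1\<close> and \<open>x\<^sub>2\<close> are the one-parameter subgroups of the two simple roots \<open>\<alpha>\<^sub>1\<close> and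
  \<open>\<alpha>\<^sub>2\<close>. Each map sends the factorisation parameters \<open>t\<close> of
  \<open>x\<^sub>1(t\<^sub>1) x\<^sub>2(t\<^sub>2) x\<^sub>1(t\<^sub>3) \<dots>\<close> to the parameters \<open>p\<close> of the same element written as
  \<open>x\<^sub>2(p\<^sub>1) x\<^sub>1(p\<^sub>2) x\<^sub>2(p\<^sub>3) \<dots>\<close>.
\<close>

definition lusztig_A2 :: "real \<times> real \<times> real \<Rightarrow> real \<times> real \<times> real" where
  "lusztig_A2 = (\<lambda>(t1, t2, t3).
     (t2 * t3 / (t1 + t3), t1 + t3, t1 * t2 / (t1 + t3)))"

text \<open>
  With \<open>x\<^sub>i(t) = exp(t e\<^sub>i)\<close>, the formulas labelled \<open>B\<^sub>2\<close> hold when \<open>\<alpha>\<^sub>1\<close> is the short simple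
  root of the group containing the \<open>x\<^sub>i\<close>, those labelled \<open>C\<^sub>2\<close> when it is the long one.
\<close>

definition lusztig_B2 :: "real \<times> real \<times> real \<times> real \<Rightarrow> real \<times> real \<times> real \<times> real" where
  "lusztig_B2 = (\<lambda>(t1, t2, t3, t4).
     let \<pi>1 = t1 * t2 + (t1 + t3) * t4;
         \<pi>2 = t1^2 * t2 + (t1 + t3)^2 * t4
     in (t2 * t3^2 * t4 / \<pi>2, \<pi>2 / \<pi>1, \<pi>1^2 / \<pi>2, t1 * t2 * t3 / \<pi>1))"

definition lusztig_C2 :: "real \<times> real \<times> real \<times> real \<Rightarrow> real \<times> real \<times> real \<times> real" where
  "lusztig_C2 = (\<lambda>(t1, t2, t3, t4).
     let \<pi>1 = t1 * t2 + (t1 + t3) * t4;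
         \<pi>2 = t3 * t4^2 + (t2 + t4)^2 * t1
     in (t2 * t3 * t4 / \<pi>1, \<pi>1^2 / \<pi>2, \<pi>2 / \<pi>1, t1 * t2^2 * t3 / \<pi>2))"

text \<open>
  Here \<open>\<alpha>\<^sub>1\<close> is the short simple root of \<open>G\<^sub>2\<close>. The monomials preserved by this map are therefore
  \<open>t\<^sub>1 t\<^sub>2 t\<^sub>3\<^sup>2 t\<^sub>4 t\<^sub>5 = p\<^sub>2 p\<^sub>3 p\<^sub>4\<^sup>2 p\<^sub>5 p\<^sub>6\<close> and
  \<open>t\<^sub>2 t\<^sub>3\<^sup>3 t\<^sub>4\<^sup>2 t\<^sub>5\<^sup>3 t\<^sub>6 = p\<^sub>1 p\<^sub>2\<^sup>3 p\<^sub>3\<^sup>2 p\<^sub>4\<^sup>3 p\<^sub>5\<close>, with exponents the coefficients of the positive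
  coroots, so that the gamma parameters compatible with the map are
  \<open>(a\<^sub>1, a\<^sub>1 + a\<^sub>2, 2a\<^sub>1 + 3a\<^sub>2, a\<^sub>1 + 2a\<^sub>2, a\<^sub>1 + 3a\<^sub>2, a\<^sub>2)\<close>, not those read off from the root coefficients
  \<open>(a\<^sub>1, 3a\<^sub>1 + a\<^sub>2, 2a\<^sub>1 + a\<^sub>2, 3a\<^sub>1 + 2a\<^sub>2, a\<^sub>1 + a\<^sub>2, a\<^sub>2)\<close>.
\<close>

definition lusztig_G2 ::
  "real \<times> real \<times> real \<times> real \<times> real \<times> real \<Rightarrow> real \<times> real \<times> real \<times> real \<times> real \<times> real" where
  "lusztig_G2 = (\<lambda>(t1, t2, t3, t4, t5, t6).
     let \<pi>1 = t1 * t2 * t3^2 * t4 + t1 * t2 * (t3 + t5)^2 * t6 + (t1 + t3) * t4 * t5^2 * t6;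
         \<pi>2 = t1^2 * t2^2 * t3^3 * t4 + t1^2 * t2^2 * (t3 + t5)^3 * t6
              + (t1 + t3)^2 * t4^2 * t5^3 * t6
              + t1 * t2 * t4 * t5^2 * t6 * (3 * t1 * t3 + 2 * t3^2 + 2 * t3 * t5 + 2 * t1 * t5);
         \<pi>3 = t1^3 * t2^2 * t3^3 * t4 + t1^3 * t2^2 * (t3 + t5)^3 * t6
              + (t1 + t3)^3 * t4^2 * t5^3 * t6
              + t1^2 * t2 * t4 * t5^2 * t6 * (3 * t1 * t3 + 3 * t3^2 + 3 * t3 * t5 + 2 * t1 * t5);
         \<pi>4 = t1^2 * t2^2 * t3^3 * t4 *
                (t1 * t2 * t3^3 * t4 + 2 * t1 * t2 * (t3 + t5)^3 * t6
                 + (3 * t1 * t3 + 3 * t3^2 + 3 * t3 * t5 + 2 * t1 * t5) * t4 * t5^2 * t6)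
              + t6^2 * (t1 * t2 * (t3 + t5)^2 + (t1 + t3) * t4 * t5^2)^3
     in (t2 * t3^3 * t4^2 * t5^3 * t6 / \<pi>3, \<pi>3 / \<pi>2, \<pi>2^3 / (\<pi>3 * \<pi>4),
         \<pi>4 / (\<pi>1 * \<pi>2), \<pi>1^3 / \<pi>4, t1 * t2 * t3^2 * t4 * t5 / \<pi>1))"

end

theory Submission
  imports Defs
begin

text \<open>
  Write \<open>L\<close> for the measure \<open>dx/x\<close> on the positive half-line. The law of \<open>\<gamma>\<^sub>a\<close> has density
  \<open>x\<^sup>a e\<^sup>-\<^sup>x / \<Gamma>(a)\<close> with respect to \<open>L\<close>, so a vector of independent gamma variables
  has density \<open>\<Prod> t\<^sub>i\<^bsup>a\<^sub>i\<^esup> exp (- \<Sum> t\<^sub>i) / \<Prod> \<Gamma>(a\<^sub>i)\<close> with respect to a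
  power \<open>L\<^sup>n\<close>. The theorem therefore follows, for each of the four changes of parameters \<open>t \<mapsto> p\<close>, from
  three properties:

  \<^item> the map sends the positive orthant injectively into itself, with a Borel inverse, and preserves \<open>L\<^sup>n\<close> (lemmas
    \<open>lusztig_A2_log_symmetry\<close>, ..., \<open>lusztig_G2_log_symmetry\<close>);
  \<^item> it preserves the sum of the coordinates;
  \<^item> it preserves the two monomials that are raised to the powers \<open>a\<^sub>1\<close> and \<open>a\<^sub>2\<close> in the density.

  The last two properties say that the density at \<open>t\<close> of one gamma vector is the density at \<open>p\<close> of the other
  (lemmas \<open>gamma_prod3_lusztig_A2\<close>, ..., \<open>gamma_prod6_lusztig_G2\<close>). The inverse map gives
  the converse implication (\<open>law_iff_of_log_symmetry\<close>).

  No Jacobian is computed. If one coordinate \<open>x\<^sub>k\<close> is replaced by \<open>c / x\<^sub>k\<close>, where \<open>c > 0\<close> depends on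
  the other coordinates only, then \<open>L\<^sup>n\<close> is preserved, because \<open>L\<close> is invariant under
  \<open>x \<mapsto> c / x\<close>; moreover such a step is an involution (\<open>log_symmetry_step\<close>). Each change of parameters is
  a composition of steps of this form. First, the parameters \<open>t\<close> are replaced one by one with the chamber variables
  \<open>A\<^sub>k = A\<^sub>k\<^sub>-\<^sub>1\<^sup>c / (A\<^sub>k\<^sub>-\<^sub>2 t\<^sub>k)\<close>, where \<open>A\<^sub>0 = A\<^sub>-\<^sub>1 = 1\<close> and
  \<open>-c\<close> is the Cartan integer of the letters in positions \<open>k - 1\<close> and \<open>k\<close>. They are the initial
  cluster of a cluster structure on the unipotent cell of \<open>w\<^sub>0\<close>, and the corresponding variables built from
  \<open>p\<close> form another of its clusters, reached by \<open>1\<close> mutation for \<open>A\<^sub>2\<close>, by \<open>3\<close> for \<open>B\<^sub>2\<close> and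
  \<open>C\<^sub>2\<close>, and by \<open>10\<close> for \<open>G\<^sub>2\<close>. A mutation replaces one variable \<open>A\<^sub>k\<close> by
  \<open>(M + M') / A\<^sub>k\<close> with monomials \<open>M\<close> and \<open>M'\<close> in the others, which is again a step. The steps of the first
  kind, run backwards, then produce \<open>p\<close>, up to swaps of two coordinates; these too are compositions of steps
  (\<open>log_symmetry_swap\<close>).
\<close>

section \<open>The measure \<open>dx/x\<close> on the positive half-line\<close>

text \<open>
  The measure \<open>dx/x\<close> on the positive half-line, as a measure on all reals: a Haar measure of the
  multiplicative group.
\<close>

definition log_lborel :: "real measure" where
  "log_lborel = density lborel (\<lambda>x. ennreal (indicator {0<..} x / x))"

lemma sets_log_lborel [simp, measurable_cong]: "sets log_lborel = sets borel"
  by (simp add: log_lborel_def)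

lemma space_log_lborel [simp]: "space log_lborel = UNIV"
  by (simp add: log_lborel_def)

lemma sigma_finite_log_lborel: "sigma_finite_measure log_lborel"
  unfolding log_lborel_def by (subst sigma_finite_measure.sigma_finite_iff_density_finite[OF sigma_finite_lborel]) auto

lemma AE_log_lborel_pos: "AE x in log_lborel. 0 < x"
  unfolding log_lborel_def by (subst AE_density) (auto simp: indicator_def)

text \<open>
  In the logarithmic coordinate \<open>ln x\<close> the measure is Lebesgue measure. The substitution rule is applied
  on \<open>[-n, n]\<close>, and \<open>n\<close> tends to infinity.
\<close>

lemma distr_exp_lborel: "distr lborel borel exp = log_lborel"
proof (rule measure_eqI)
  fix A assume "A \<in> sets (distr lborel borel (exp :: real \<Rightarrow> real))"
  hence A [measurable]: "A \<in> sets borel" by simp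
  let ?I = "\<lambda>n. {exp (- real n)..exp (real n)}"
  have cover: "(SUP n. indicator {- real n..real n} u) = (1 :: ennreal)" for u
  proof -
    obtain n where "\<bar>u\<bar> \<le> real n" using real_arch_simple by blast
    hence n: "indicator {- real n..real n} u = (1 :: ennreal)" by (auto simp: indicator_def)
    thus ?thesis
      by (intro antisym SUP_least SUP_upper2[of n UNIV]) (simp_all add: indicator_def split: if_splits)
  qed
  have coverI: "(SUP n. indicator (?I n) x) = (indicator {0<..} x :: ennreal)" for x
  proof (cases "0 < x")
    case True
    hence "x \<in> ?I n \<longleftrightarrow> ln x \<in> {- real n..real n}" for n
      by (metis atLeastAtMost_iff exp_le_cancel_iff exp_ln)
    hence "indicator (?I n) x = (indicator {- real n..real n} (ln x) :: ennreal)" for n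
      by (simp only: indicator_def)
    thus ?thesis using cover[of "ln x"] True by simp
  next
    case False
    hence "indicator (?I n) x = (0 :: ennreal)" for n
      using exp_gt_zero[of "- real n"] by (auto simp: indicator_def simp del: exp_gt_zero)
    thus ?thesis using False by simp
  qed
  have incA: "incseq (\<lambda>n x. f x * (indicator (A n) x :: ennreal))"
    if "\<And>m n. m \<le> n \<Longrightarrow> A m \<subseteq> A n" for f :: "real \<Rightarrow> ennreal" and A :: "nat \<Rightarrow> real set"
    using that by (intro monoI le_funI mult_left_mono) (auto simp: indicator_def)
  have inc: "incseq (\<lambda>n x. f x * (indicator {- real n..real n} x :: ennreal))" for f :: "real \<Rightarrow> ennreal"
    by (intro incA) auto
  have incI: "incseq (\<lambda>n x. f x * (indicator (?I n) x :: ennreal))" for f :: "real \<Rightarrow> ennreal"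
    by (intro incA) auto
  have *: "(\<integral>\<^sup>+x. ennreal (indicator A x / x) * indicator (?I n) x \<partial>lborel)
      = (\<integral>\<^sup>+u. indicator A (exp u) * indicator {- real n..real n} u \<partial>lborel)" for n
  proof -
    have "(\<integral>\<^sup>+x. ennreal (indicator A x / x) * indicator (?I n) x \<partial>lborel)
      = (\<integral>\<^sup>+x. ennreal (indicator A x / x * indicator (?I n) x) \<partial>lborel)"
      by (intro nn_integral_cong) (simp add: indicator_def)
    also have "\<dots> = (\<integral>\<^sup>+u. ennreal (indicator A (exp u) / exp u * exp u * indicator {- real n..real n} u) \<partial>lborel)"
      by (rule nn_integral_substitution)
         (auto simp: set_borel_measurable_def intro!: derivative_eq_intros continuous_intros)
    also have "\<dots> = (\<integral>\<^sup>+u. indicator A (exp u) * indicator {- real n..real n} u \<partial>lborel)"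
      by (intro nn_integral_cong) (simp add: indicator_def)
    finally show ?thesis .
  qed
  have "emeasure log_lborel A = (\<integral>\<^sup>+x. ennreal (indicator {0<..} x / x) * indicator A x \<partial>lborel)"
    unfolding log_lborel_def by (subst emeasure_density) auto
  also have "\<dots> = (\<integral>\<^sup>+x. (SUP n. ennreal (indicator A x / x) * indicator (?I n) x) \<partial>lborel)"
    unfolding SUP_mult_left_ennreal[symmetric] coverI
    by (intro nn_integral_cong) (auto simp: indicator_def)
  also have "\<dots> = (SUP n. \<integral>\<^sup>+x. ennreal (indicator A x / x) * indicator (?I n) x \<partial>lborel)"
    by (intro nn_integral_monotone_convergence_SUP incI) auto
  also have "\<dots> = (SUP n. \<integral>\<^sup>+u. indicator A (exp u) * indicator {- real n..real n} u \<partial>lborel)"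
    by (simp add: *)
  also have "\<dots> = (\<integral>\<^sup>+u. (SUP n. indicator A (exp u) * indicator {- real n..real n} u) \<partial>lborel)"
    by (intro nn_integral_monotone_convergence_SUP[symmetric] inc) auto
  also have "\<dots> = (\<integral>\<^sup>+u. indicator A (exp u) \<partial>lborel)"
    unfolding SUP_mult_left_ennreal[symmetric] cover by simp
  also have "\<dots> = (\<integral>\<^sup>+x. indicator A x \<partial>distr lborel borel exp)"
    by (subst nn_integral_distr) auto
  finally show "emeasure (distr lborel borel exp) A = emeasure log_lborel A" by simp
qed (simp add: log_lborel_def)

lemma nn_integral_log_lborel_reflect:
  assumes [measurable]: "f \<in> borel_measurable borel" and "0 < c"
  shows "(\<integral>\<^sup>+x. f (c / x) \<partial>log_lborel) = (\<integral>\<^sup>+x. f x \<partial>log_lborel)"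
proof -
  have "(\<integral>\<^sup>+x. f (c / x) \<partial>log_lborel) = (\<integral>\<^sup>+u. f (exp (ln c + (- 1) * u)) \<partial>lborel)"
    using \<open>0 < c\<close> by (simp add: nn_integral_distr exp_diff flip: distr_exp_lborel)
  also have "\<dots> = (\<integral>\<^sup>+u. f (exp u) \<partial>lborel)"
    by (subst nn_integral_real_affine[of "\<lambda>u. f (exp u)" "- 1" "ln c"]) auto
  also have "\<dots> = (\<integral>\<^sup>+x. f x \<partial>log_lborel)"
    by (simp add: nn_integral_distr flip: distr_exp_lborel)
  finally show ?thesis .
qed

section \<open>Positive coordinates\<close>

text \<open>
  A \<open>\<sigma>\<close>-finite Borel measure carried by the set \<open>P\<close>; below, a power of \<^const>\<open>log_lborel\<close> and the open
  positive orthant.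
\<close>

definition positive_space :: "'a::second_countable_topology measure \<Rightarrow> 'a set \<Rightarrow> bool" where
  "positive_space N P \<longleftrightarrow> sets N = sets borel \<and> sigma_finite_measure N \<and> P \<in> sets borel \<and> (AE x in N. x \<in> P)"

lemma positive_space_log_lborel: "positive_space log_lborel {0<..}"
  using sigma_finite_log_lborel AE_log_lborel_pos by (auto simp: positive_space_def)

lemma positive_space_pair:
  assumes "positive_space M P" and "positive_space N Q"
  shows "positive_space (M \<Otimes>\<^sub>M N) (P \<times> Q)"
proof -
  interpret M: sigma_finite_measure M using assms by (simp add: positive_space_def)
  interpret N: sigma_finite_measure N using assms by (simp add: positive_space_def)
  interpret pair_sigma_finite M N ..
  have sets: "sets M = sets borel" "sets N = sets borel" "P \<in> sets borel" "Q \<in> sets borel"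
    using assms by (auto simp: positive_space_def)
  have s: "sets (M \<Otimes>\<^sub>M N) = sets borel"
    using sets_pair_measure_cong[OF sets(1,2)] borel_prod by metis
  have PQ: "P \<times> Q \<in> sets borel"
    using sets by (auto simp flip: borel_prod)
  have "AE x in M \<Otimes>\<^sub>M N. x \<in> P \<times> Q"
  proof (rule AE_pair_measure)
    show "{x \<in> space (M \<Otimes>\<^sub>M N). x \<in> P \<times> Q} \<in> sets (M \<Otimes>\<^sub>M N)"
      using PQ sets_eq_imp_space_eq[OF s] s by (simp add: Collect_mem_eq)
    show "AE x in M. AE y in N. (x, y) \<in> P \<times> Q"
      using assms by (auto simp: positive_space_def elim!: AE_mp)
  qed
  thus ?thesis using s PQ sigma_finite_measure_axioms by (simp add: positive_space_def)
qed

text \<open>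
  A positive coordinate of a space \<open>(N, P)\<close>: \<open>g x\<close> reads the coordinate at the point \<open>x\<close>, and \<open>u y x\<close> is
  \<open>x\<close> with this coordinate set to \<open>y\<close>. Besides the usual laws of reading and updating, the measure \<open>N\<close> is
  required to be invariant when the coordinate \<open>y\<close> is replaced by \<open>c / y\<close>, for every positive coefficient \<open>c\<close>
  that does not depend on this coordinate. Invariance is stated through nonnegative integrals.
\<close>

definition log_coord ::
  "'a::second_countable_topology measure \<Rightarrow> 'a set \<Rightarrow> ('a \<Rightarrow> real) \<Rightarrow> (real \<Rightarrow> 'a \<Rightarrow> 'a) \<Rightarrow> bool" where
  "log_coord N P g u \<longleftrightarrow>
     g \<in> borel_measurable borel \<and> (\<lambda>(y, x). u y x) \<in> borel_measurable borel \<and>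
     (\<forall>x\<in>P. 0 < g x \<and> (\<forall>y>0. u y x \<in> P)) \<and>
     (\<forall>x y. g (u y x) = y) \<and> (\<forall>x. u (g x) x = x) \<and> (\<forall>x y z. u y (u z x) = u y x) \<and>
     (\<forall>f c. f \<in> borel_measurable borel \<longrightarrow> c \<in> borel_measurable borel \<longrightarrow> (\<forall>x\<in>P. 0 < c x) \<longrightarrow>
        (\<forall>x y. c (u y x) = c x) \<longrightarrow> (\<integral>\<^sup>+x. f (u (c x / g x) x) \<partial>N) = (\<integral>\<^sup>+x. f x \<partial>N))"

lemma log_coord_log_lborel: "log_coord log_lborel {0<..} (\<lambda>x. x) (\<lambda>y x. y)"
proof -
  have "(\<integral>\<^sup>+x. f (c x / x) \<partial>log_lborel) = (\<integral>\<^sup>+x. f x \<partial>log_lborel)"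
    if "f \<in> borel_measurable borel" "\<forall>x\<in>{0<..}. 0 < c x" "\<forall>x y. c y = c x" for f and c :: "real \<Rightarrow> real"
  proof -
    define k where "k = c 1"
    have c: "c = (\<lambda>_. k)" unfolding k_def using that(3) by (intro ext) blast
    moreover have "0 < k" unfolding k_def using that(2) by simp
    ultimately show ?thesis using nn_integral_log_lborel_reflect[OF that(1)] by simp
  qed
  moreover have "(\<lambda>(y, x :: real). y :: real) \<in> borel_measurable borel"
    by (simp add: case_prod_beta' flip: borel_prod)
  ultimately show ?thesis unfolding log_coord_def by auto
qed

text \<open>
  By Fubini's theorem, the coordinates of a product of \<^const>\<open>log_lborel\<close> with \<open>N\<close> are the first component
  and the coordinates of \<open>N\<close>.
\<close>

lemma log_coord_fst:
  assumes N: "positive_space N P"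
  shows "log_coord (log_lborel \<Otimes>\<^sub>M N) ({0<..} \<times> P) fst (\<lambda>y p. (y, snd p))"
proof -
  interpret L: sigma_finite_measure log_lborel by (rule sigma_finite_log_lborel)
  interpret N: sigma_finite_measure N using N by (simp add: positive_space_def)
  interpret pair_sigma_finite log_lborel N ..
  have sN [measurable_cong]: "sets N = sets borel" using N by (simp add: positive_space_def)
  have s: "sets (log_lborel \<Otimes>\<^sub>M N) = sets borel"
    using sets_pair_measure_cong[OF sets_log_lborel sN] borel_prod by metis
  have "(\<integral>\<^sup>+x. f (c x / fst x, snd x) \<partial>(log_lborel \<Otimes>\<^sub>M N)) = (\<integral>\<^sup>+x. f x \<partial>(log_lborel \<Otimes>\<^sub>M N))"
    if f: "f \<in> borel_measurable borel" and c: "c \<in> borel_measurable borel"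
      and pos: "\<forall>x\<in>{0<..} \<times> P. 0 < c x" and inv: "\<forall>x y. c (y, snd x) = c x"
    for f and c :: "real \<times> 'a \<Rightarrow> real"
  proof -
    have [measurable]: "f \<in> borel_measurable (borel \<Otimes>\<^sub>M borel)" "c \<in> borel_measurable (borel \<Otimes>\<^sub>M borel)"
      using f c by (simp_all add: borel_prod)
    have c1: "c (x, r) = c (1, r)" for x r using inv by (metis snd_conv)
    have "(\<integral>\<^sup>+x. f (c x / fst x, snd x) \<partial>(log_lborel \<Otimes>\<^sub>M N))
        = (\<integral>\<^sup>+r. \<integral>\<^sup>+x. f (c (1, r) / x, r) \<partial>log_lborel \<partial>N)"
      by (subst nn_integral_snd[symmetric], simp, intro nn_integral_cong arg_cong[where f = f])
         (metis c1 fst_conv snd_conv)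
    also have "\<dots> = (\<integral>\<^sup>+r. \<integral>\<^sup>+x. f (x, r) \<partial>log_lborel \<partial>N)"
    proof (rule nn_integral_cong_AE)
      have "AE r in N. r \<in> P" using N by (simp add: positive_space_def)
      thus "AE r in N. (\<integral>\<^sup>+x. f (c (1, r) / x, r) \<partial>log_lborel) = (\<integral>\<^sup>+x. f (x, r) \<partial>log_lborel)"
      proof eventually_elim
        case (elim r)
        thus ?case using pos by (intro nn_integral_log_lborel_reflect[of "\<lambda>x. f (x, r)"]) auto
      qed
    qed
    also have "\<dots> = (\<integral>\<^sup>+x. f x \<partial>(log_lborel \<Otimes>\<^sub>M N))"
      by (subst nn_integral_snd[symmetric]) simp_all
    finally show ?thesis .
  qed
  moreover have "(\<lambda>(y, p). (y, snd p)) \<in> borel_measurable (borel :: (real \<times> real \<times> 'a) measure)"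
    by (simp add: case_prod_beta' flip: borel_prod)
  moreover have "fst \<in> borel_measurable (borel :: (real \<times> 'a) measure)"
    by (simp flip: borel_prod)
  ultimately show ?thesis unfolding log_coord_def by auto
qed

lemma log_coord_snd:
  assumes N: "positive_space N P" and gu: "log_coord N P g u"
  shows "log_coord (log_lborel \<Otimes>\<^sub>M N) ({0<..} \<times> P) (\<lambda>p. g (snd p)) (\<lambda>y p. (fst p, u y (snd p)))"
proof -
  interpret L: sigma_finite_measure log_lborel by (rule sigma_finite_log_lborel)
  interpret N: sigma_finite_measure N using N by (simp add: positive_space_def)
  interpret pair_sigma_finite log_lborel N ..
  have sN [measurable_cong]: "sets N = sets borel" using N by (simp add: positive_space_def)
  have [measurable]: "g \<in> borel_measurable borel" "(\<lambda>(y, x). u y x) \<in> borel \<Otimes>\<^sub>M borel \<rightarrow>\<^sub>M borel"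
    using gu by (auto simp: log_coord_def borel_prod)
  have "(\<integral>\<^sup>+x. f (fst x, u (c x / g (snd x)) (snd x)) \<partial>(log_lborel \<Otimes>\<^sub>M N)) = (\<integral>\<^sup>+x. f x \<partial>(log_lborel \<Otimes>\<^sub>M N))"
    if f: "f \<in> borel_measurable borel" and c: "c \<in> borel_measurable borel"
      and pos: "\<forall>x\<in>{0<..} \<times> P. 0 < c x" and inv: "\<forall>x y. c (fst x, u y (snd x)) = c x"
    for f and c :: "real \<times> 'a \<Rightarrow> real"
  proof -
    have [measurable]: "f \<in> borel_measurable (borel \<Otimes>\<^sub>M borel)" "c \<in> borel_measurable (borel \<Otimes>\<^sub>M borel)"
      using f c by (simp_all add: borel_prod)
    have "(\<integral>\<^sup>+x. f (fst x, u (c x / g (snd x)) (snd x)) \<partial>(log_lborel \<Otimes>\<^sub>M N))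
        = (\<integral>\<^sup>+x. \<integral>\<^sup>+r. f (x, u (c (x, r) / g r) r) \<partial>N \<partial>log_lborel)"
      by (subst N.nn_integral_fst[symmetric]) simp_all
    also have "\<dots> = (\<integral>\<^sup>+x. \<integral>\<^sup>+r. f (x, r) \<partial>N \<partial>log_lborel)"
    proof (rule nn_integral_cong_AE)
      show "AE x in log_lborel. (\<integral>\<^sup>+r. f (x, u (c (x, r) / g r) r) \<partial>N) = (\<integral>\<^sup>+r. f (x, r) \<partial>N)"
        using AE_log_lborel_pos
      proof eventually_elim
        case (elim x)
        have "(\<lambda>r. f (x, r)) \<in> borel_measurable borel" "(\<lambda>r. c (x, r)) \<in> borel_measurable borel" by measurable
        moreover have "\<forall>r\<in>P. 0 < c (x, r)" using elim pos by auto
        moreover have "\<forall>r y. c (x, u y r) = c (x, r)" using inv by (metis fst_conv snd_conv)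
        ultimately show ?case using gu unfolding log_coord_def by meson
      qed
    qed
    also have "\<dots> = (\<integral>\<^sup>+x. f x \<partial>(log_lborel \<Otimes>\<^sub>M N))"
      by (subst N.nn_integral_fst[symmetric]) simp_all
    finally show ?thesis .
  qed
  moreover have "(\<lambda>p. g (snd p)) \<in> borel_measurable (borel :: (real \<times> 'a) measure)"
    by (simp flip: borel_prod)
  moreover have "(\<lambda>(y, p). (fst p, u y (snd p))) \<in> borel_measurable (borel :: (real \<times> real \<times> 'a) measure)"
    by (simp add: case_prod_beta' flip: borel_prod)
  ultimately show ?thesis using gu unfolding log_coord_def by auto
qed

text \<open>
  Powers of \<^const>\<open>log_lborel\<close> and positive orthants. Tuples are nested to the right, hence so are the products.
\<close>

abbreviation "log_lborel2 \<equiv> log_lborel \<Otimes>\<^sub>M log_lborel"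
abbreviation "log_lborel3 \<equiv> log_lborel \<Otimes>\<^sub>M log_lborel2"
abbreviation "log_lborel4 \<equiv> log_lborel \<Otimes>\<^sub>M log_lborel3"
abbreviation "log_lborel5 \<equiv> log_lborel \<Otimes>\<^sub>M log_lborel4"
abbreviation "log_lborel6 \<equiv> log_lborel \<Otimes>\<^sub>M log_lborel5"
abbreviation "orthant2 \<equiv> {0::real<..} \<times> {0::real<..}"
abbreviation "orthant3 \<equiv> {0::real<..} \<times> orthant2"
abbreviation "orthant4 \<equiv> {0::real<..} \<times> orthant3"
abbreviation "orthant5 \<equiv> {0::real<..} \<times> orthant4"
abbreviation "orthant6 \<equiv> {0::real<..} \<times> orthant5"

lemmas positive_space_log_lborel2 = positive_space_pair[OF positive_space_log_lborel positive_space_log_lborel]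
lemmas positive_space_log_lborel3 = positive_space_pair[OF positive_space_log_lborel positive_space_log_lborel2]
lemmas positive_space_log_lborel4 = positive_space_pair[OF positive_space_log_lborel positive_space_log_lborel3]
lemmas positive_space_log_lborel5 = positive_space_pair[OF positive_space_log_lborel positive_space_log_lborel4]
lemmas positive_space_log_lborel6 = positive_space_pair[OF positive_space_log_lborel positive_space_log_lborel5]

text \<open>
  The fact \<open>coordn_k\<close> says that the \<open>k\<close>-th component of an \<open>n\<close>-tuple is a coordinate.
\<close>

lemmas coord2_1 = log_coord_fst[OF positive_space_log_lborel]
lemmas coord2_2 = log_coord_snd[OF positive_space_log_lborel log_coord_log_lborel]

lemmas coord3_1 = log_coord_fst[OF positive_space_log_lborel2]
lemmas coord3_2 = log_coord_snd[OF positive_space_log_lborel2 coord2_1]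
lemmas coord3_3 = log_coord_snd[OF positive_space_log_lborel2 coord2_2]

lemmas coord4_1 = log_coord_fst[OF positive_space_log_lborel3]
lemmas coord4_2 = log_coord_snd[OF positive_space_log_lborel3 coord3_1]
lemmas coord4_3 = log_coord_snd[OF positive_space_log_lborel3 coord3_2]
lemmas coord4_4 = log_coord_snd[OF positive_space_log_lborel3 coord3_3]

lemmas coord5_1 = log_coord_fst[OF positive_space_log_lborel4]
lemmas coord5_2 = log_coord_snd[OF positive_space_log_lborel4 coord4_1]
lemmas coord5_3 = log_coord_snd[OF positive_space_log_lborel4 coord4_2]
lemmas coord5_4 = log_coord_snd[OF positive_space_log_lborel4 coord4_3]
lemmas coord5_5 = log_coord_snd[OF positive_space_log_lborel4 coord4_4]

lemmas coord6_1 = log_coord_fst[OF positive_space_log_lborel5]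
lemmas coord6_2 = log_coord_snd[OF positive_space_log_lborel5 coord5_1]
lemmas coord6_3 = log_coord_snd[OF positive_space_log_lborel5 coord5_2]
lemmas coord6_4 = log_coord_snd[OF positive_space_log_lborel5 coord5_3]
lemmas coord6_5 = log_coord_snd[OF positive_space_log_lborel5 coord5_4]
lemmas coord6_6 = log_coord_snd[OF positive_space_log_lborel5 coord5_5]

section \<open>Symmetries of the measure\<close>

text \<open>
  \<open>\<Phi>\<close> is an injective self-map of \<open>P\<close> with Borel inverse on its image, and it preserves \<open>N\<close>. Only the values of
  \<open>\<Phi>\<close> on \<open>P\<close> matter, hence the Borel function \<open>F\<close> that agrees with \<open>\<Phi>\<close> there.
\<close>

definition log_symmetry :: "'a::second_countable_topology measure \<Rightarrow> 'a set \<Rightarrow> ('a \<Rightarrow> 'a) \<Rightarrow> bool" where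
  "log_symmetry N P \<Phi> \<longleftrightarrow> (\<exists>F G. F \<in> borel_measurable borel \<and> G \<in> borel_measurable borel \<and>
     (\<forall>x\<in>P. F x = \<Phi> x \<and> \<Phi> x \<in> P \<and> G (\<Phi> x) = x) \<and>
     (\<forall>f\<in>borel_measurable borel. (\<integral>\<^sup>+x. f (F x) \<partial>N) = (\<integral>\<^sup>+x. f x \<partial>N)))"

lemma log_symmetry_id: "log_symmetry N P (\<lambda>x. x)"
  unfolding log_symmetry_def by (intro exI[of _ "\<lambda>x. x"]) auto

lemma log_symmetry_cong:
  assumes "log_symmetry N P \<Phi>" and "\<And>x. x \<in> P \<Longrightarrow> \<Phi>' x = \<Phi> x"
  shows "log_symmetry N P \<Phi>'"
  using assms unfolding log_symmetry_def by auto

text \<open>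
  The composition of \<open>\<Phi>\<close> with a step that replaces one coordinate of the value by \<open>c\<close> divided by it.
\<close>

lemma log_symmetry_step:
  assumes gu: "log_coord N P g u" and \<Phi>: "log_symmetry N P \<Phi>"
    and c: "c \<in> borel_measurable borel" "\<And>x. x \<in> P \<Longrightarrow> 0 < c x" "\<And>x y. c (u y x) = c x"
    and \<Phi>': "\<And>x. x \<in> P \<Longrightarrow> \<Phi>' x = u (c (\<Phi> x) / g (\<Phi> x)) (\<Phi> x)"
  shows "log_symmetry N P \<Phi>'"
proof -
  from \<Phi> obtain F G where F: "F \<in> borel_measurable borel" and G: "G \<in> borel_measurable borel"
    and FG: "\<And>x. x \<in> P \<Longrightarrow> F x = \<Phi> x" "\<And>x. x \<in> P \<Longrightarrow> \<Phi> x \<in> P" "\<And>x. x \<in> P \<Longrightarrow> G (\<Phi> x) = x"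
    and int: "\<And>f. f \<in> borel_measurable borel \<Longrightarrow> (\<integral>\<^sup>+x. f (F x) \<partial>N) = (\<integral>\<^sup>+x. f x \<partial>N)"
    unfolding log_symmetry_def by auto
  have gm [measurable]: "g \<in> borel_measurable borel"
    and um: "(\<lambda>(y, x). u y x) \<in> borel_measurable borel"
    and pos: "\<And>x. x \<in> P \<Longrightarrow> 0 < g x" "\<And>x y. x \<in> P \<Longrightarrow> 0 < y \<Longrightarrow> u y x \<in> P"
    and lens: "\<And>x y. g (u y x) = y" "\<And>x. u (g x) x = x" "\<And>x y z. u y (u z x) = u y x"
    and refl_int: "\<And>f c. f \<in> borel_measurable borel \<Longrightarrow> c \<in> borel_measurable borel \<Longrightarrow>
      (\<And>x. x \<in> P \<Longrightarrow> 0 < c x) \<Longrightarrow> (\<And>x y. c (u y x) = c x) \<Longrightarrow>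
      (\<integral>\<^sup>+x. f (u (c x / g x) x) \<partial>N) = (\<integral>\<^sup>+x. f x \<partial>N)"
    using gu unfolding log_coord_def by auto
  have um' [measurable]: "(\<lambda>(y, x). u y x) \<in> borel \<Otimes>\<^sub>M borel \<rightarrow>\<^sub>M borel"
    using um by (simp add: borel_prod)
  note c(1) [measurable]
  define S where "S x = u (c x / g x) x" for x
  have Sm: "S \<in> borel_measurable borel"
    unfolding S_def[abs_def] by measurable
  \<comment> \<open>The step \<open>S\<close> is an involution: the coefficient \<open>c\<close> does not see the coordinate that it moves.\<close>
  have SS: "S (S x) = x" if "x \<in> P" for x
    using c(2)[OF that] pos(1)[OF that] by (simp add: S_def c(3) lens)
  have SP: "S x \<in> P" if "x \<in> P" for x
    using that c(2) pos by (simp add: S_def)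
  have "(\<integral>\<^sup>+x. f (S (F x)) \<partial>N) = (\<integral>\<^sup>+x. f x \<partial>N)" if f: "f \<in> borel_measurable borel" for f
  proof -
    have "(\<integral>\<^sup>+x. f (S (F x)) \<partial>N) = (\<integral>\<^sup>+x. f (S x) \<partial>N)"
      using int[of "\<lambda>x. f (S x)"] f Sm by (simp add: measurable_compose)
    also have "\<dots> = (\<integral>\<^sup>+x. f x \<partial>N)"
      using refl_int[OF f c] by (simp add: S_def)
    finally show ?thesis .
  qed
  moreover have "\<Phi>' x = S (\<Phi> x)" if "x \<in> P" for x
    using \<Phi>'[OF that] by (simp add: S_def)
  ultimately show ?thesis
    unfolding log_symmetry_def using F G FG Sm SS SP
    by (intro exI[of _ "\<lambda>x. S (F x)"] exI[of _ "\<lambda>x. G (S x)"] conjI ballI)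
       (auto intro: measurable_compose[OF F Sm] measurable_compose[OF Sm G])
qed

lemma log_symmetry_swap:
  assumes gu: "log_coord N P g u" and hv: "log_coord N P h v" and \<Phi>: "log_symmetry N P \<Phi>"
    and indep: "\<And>x y. h (u y x) = h x" "\<And>x y. g (v y x) = g x" "\<And>x y z. u y (v z x) = v z (u y x)"
  shows "log_symmetry N P (\<lambda>x. u (h (\<Phi> x)) (v (g (\<Phi> x)) (\<Phi> x)))"
proof -
  have gm: "g \<in> borel_measurable borel" "h \<in> borel_measurable borel"
    and lens: "\<And>x y. g (u y x) = y" "\<And>x. u (g x) x = x" "\<And>x y z. u y (u z x) = u y x"
      "\<And>x y. h (v y x) = y" "\<And>x. v (h x) x = x" "\<And>x y z. v y (v z x) = v y x"
    and pos: "\<And>x. x \<in> P \<Longrightarrow> 0 < g x" "\<And>x. x \<in> P \<Longrightarrow> 0 < h x"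
    using gu hv unfolding log_coord_def by auto
  have \<Phi>P: "\<Phi> x \<in> P" if "x \<in> P" for x
    using \<Phi> that unfolding log_symmetry_def by auto
  have nz: "g (\<Phi> x) \<noteq> 0" "h (\<Phi> x) \<noteq> 0" if "x \<in> P" for x
    using pos[OF \<Phi>P[OF that]] by auto
  define \<Phi>1 where "\<Phi>1 x = u (h (\<Phi> x) / g (\<Phi> x)) (\<Phi> x)" for x
  define \<Phi>2 where "\<Phi>2 x = v (1 / g (\<Phi> x)) (\<Phi>1 x)" for x
  define \<Phi>3 where "\<Phi>3 x = u (1 / h (\<Phi> x)) (\<Phi>2 x)" for x
  define \<Phi>4 where "\<Phi>4 x = u (h (\<Phi> x)) (\<Phi>3 x)" for x
  \<comment> \<open>Reflections act on the exponents of two coordinates \<open>(x, y)\<close> as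
    \<open>(y/x, y)\<close>, \<open>(y/x, 1/x)\<close>, \<open>(1/y, 1/x)\<close>, \<open>(y, 1/x)\<close>, \<open>(y, x)\<close>.\<close>
  have 1: "log_symmetry N P \<Phi>1"
    by (rule log_symmetry_step[OF gu \<Phi>, of h]) (auto simp: \<Phi>1_def gm pos indep)
  have 2: "log_symmetry N P \<Phi>2"
    by (rule log_symmetry_step[OF hv 1, of g])
       (auto simp: \<Phi>1_def \<Phi>2_def gm indep lens pos nz)
  have 3: "log_symmetry N P \<Phi>3"
    by (rule log_symmetry_step[OF gu 2, of h])
       (auto simp: \<Phi>1_def \<Phi>2_def \<Phi>3_def gm indep lens pos nz)
  have 4: "log_symmetry N P \<Phi>4"
    by (rule log_symmetry_step[OF gu 3, of "\<lambda>_. 1"])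
       (auto simp: \<Phi>1_def \<Phi>2_def \<Phi>3_def \<Phi>4_def gm indep lens)
  show ?thesis
    by (rule log_symmetry_step[OF hv 4, of "\<lambda>_. 1"])
       (auto simp: \<Phi>1_def \<Phi>2_def \<Phi>3_def \<Phi>4_def gm indep lens)
qed

text \<open>
  The transfer of laws: a symmetry \<open>\<Phi>\<close> of \<open>N\<close> carries the measure with density \<open>f\<^sub>2 \<circ> \<Phi>\<close> to the measure with
  density \<open>f\<^sub>2\<close>, and the inverse of \<open>\<Phi>\<close> carries it back.
\<close>

lemma law_iff_of_log_symmetry:
  assumes N: "positive_space N P" and \<Phi>: "log_symmetry N P \<Phi>"
    and \<Phi>m: "\<Phi> \<in> borel_measurable borel"
    and [measurable]: "f1 \<in> borel_measurable borel" "f2 \<in> borel_measurable borel"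
    and D: "D1 = density N f1" "D2 = density N f2"
    and f: "\<And>x. x \<in> P \<Longrightarrow> f1 x = f2 (\<Phi> x)"
    and X: "X \<in> borel_measurable M" "AE \<omega> in M. X \<omega> \<in> P"
  shows "distr M borel X = D1 \<longleftrightarrow> distr M borel (\<lambda>\<omega>. \<Phi> (X \<omega>)) = D2"
proof -
  from \<Phi> obtain F G where [measurable]: "F \<in> borel_measurable borel" "G \<in> borel_measurable borel"
    and FG: "\<And>x. x \<in> P \<Longrightarrow> F x = \<Phi> x" "\<And>x. x \<in> P \<Longrightarrow> \<Phi> x \<in> P" "\<And>x. x \<in> P \<Longrightarrow> G (\<Phi> x) = x"
    and int: "\<And>f. f \<in> borel_measurable borel \<Longrightarrow> (\<integral>\<^sup>+x. f (F x) \<partial>N) = (\<integral>\<^sup>+x. f x \<partial>N)"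
    unfolding log_symmetry_def by auto
  have [measurable_cong]: "sets N = sets borel" and AE: "AE x in N. x \<in> P"
    using N by (auto simp: positive_space_def)
  note [measurable] = \<Phi>m X(1)
  have dF: "distr N borel F = N"
  proof (rule measure_eqI)
    fix A assume "A \<in> sets (distr N borel F)"
    hence [measurable]: "A \<in> sets borel" by simp
    have "emeasure (distr N borel F) A = (\<integral>\<^sup>+x. indicator A x \<partial>distr N borel F)" by simp
    also have "\<dots> = (\<integral>\<^sup>+x. indicator A (F x) \<partial>N)" by (rule nn_integral_distr) auto
    also have "\<dots> = (\<integral>\<^sup>+x. indicator A x \<partial>N)" by (rule int) simp
    finally show "emeasure (distr N borel F) A = emeasure N A" by simp
  qed (simp add: \<open>sets N = sets borel\<close>)
  have AE1: "AE x in D1. x \<in> P"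
    unfolding D by (subst AE_density) (use AE in auto)
  have sD1 [measurable_cong]: "sets D1 = sets borel" by (simp add: D \<open>sets N = sets borel\<close>)
  have "D1 = density N (\<lambda>x. f2 (F x))"
    unfolding D by (intro density_cong) (use AE FG f in auto)
  hence "distr D1 borel F = density (distr N borel F) f2"
    by (simp add: density_distr)
  moreover have "distr D1 borel F = distr D1 borel \<Phi>"
    using AE1 FG by (intro distr_cong_AE) auto
  ultimately have D2: "D2 = distr D1 borel \<Phi>"
    by (simp add: dF D(2))
  show ?thesis
  proof
    assume "distr M borel X = D1"
    thus "distr M borel (\<lambda>\<omega>. \<Phi> (X \<omega>)) = D2"
      by (auto simp: D2 distr_distr comp_def)
  next
    assume *: "distr M borel (\<lambda>\<omega>. \<Phi> (X \<omega>)) = D2"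
    have "distr M borel X = distr M borel (\<lambda>\<omega>. G (\<Phi> (X \<omega>)))"
      using X(2) FG by (intro distr_cong_AE) auto
    also have "\<dots> = distr (distr M borel (\<lambda>\<omega>. \<Phi> (X \<omega>))) borel G"
      by (simp add: distr_distr comp_def)
    also have "\<dots> = distr D1 borel (\<lambda>x. G (\<Phi> x))"
      unfolding * D2 by (simp add: distr_distr comp_def)
    also have "\<dots> = distr D1 borel (\<lambda>x. x)"
      using AE1 FG by (intro distr_cong_AE) auto
    also have "\<dots> = D1" by (simp add: distr_id2 sD1)
    finally show "distr M borel X = D1" .
  qed
qed

section \<open>Gamma laws\<close>

text \<open>
  The density of the gamma law with respect to \<^const>\<open>log_lborel\<close>, on the positive half-line; the
  values elsewhere are irrelevant. Powers are written through \<^const>\<open>ln\<close> so that products of such densities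
  become sums of exponents.
\<close>

definition gamma_log_density :: "real \<Rightarrow> real \<Rightarrow> real" where
  "gamma_log_density a x = exp (a * ln x - x) / Gamma a"

lemma gamma_log_density_measurable [measurable]: "gamma_log_density a \<in> borel_measurable borel"
  unfolding gamma_log_density_def by measurable

lemma gamma_log_density_nonneg: "0 < a \<Longrightarrow> 0 \<le> gamma_log_density a x"
  by (simp add: gamma_log_density_def Gamma_real_pos less_imp_le)

lemma gamma_law_eq_density:
  assumes "0 < a"
  shows "gamma_law a = density log_lborel (\<lambda>x. ennreal (gamma_log_density a x))"
proof -
  have "ennreal (gamma_density a x) = ennreal (indicator {0<..} x / x) * ennreal (gamma_log_density a x)" for x
  proof (cases "0 < x")
    case True
    have "x powr (a - 1) * exp (- x) / Gamma a = 1 / x * gamma_log_density a x"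
      using True by (simp add: gamma_log_density_def powr_diff powr_def exp_diff exp_minus field_simps)
    thus ?thesis using True by (simp add: gamma_density_def flip: ennreal_mult')
  qed (simp add: gamma_density_def)
  thus ?thesis
    unfolding log_lborel_def gamma_law_def by (subst density_density_eq) auto
qed

text \<open>
  \<open>D\<close> has the nonnegative Borel density \<open>f\<close> with respect to \<open>N\<close>, and is \<open>\<sigma>\<close>-finite so that products with it can
  be formed.
\<close>

definition has_real_density :: "'a::second_countable_topology measure \<Rightarrow> 'a measure \<Rightarrow> ('a \<Rightarrow> real) \<Rightarrow> bool" where
  "has_real_density D N f \<longleftrightarrow> f \<in> borel_measurable borel \<and> (\<forall>x. 0 \<le> f x) \<and>
     D = density N (\<lambda>x. ennreal (f x)) \<and> sigma_finite_measure D"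

lemma has_real_density_gamma_law:
  assumes "0 < a"
  shows "has_real_density (gamma_law a) log_lborel (gamma_log_density a)"
proof -
  interpret prob_space "gamma_law a" by (rule prob_space_gamma_law) fact
  show ?thesis
    using gamma_law_eq_density[OF assms] gamma_log_density_nonneg[OF assms] sigma_finite_measure_axioms
    by (auto simp: has_real_density_def)
qed

lemma has_real_density_gamma_law_pair:
  assumes "0 < a" and N: "positive_space N P" and D: "has_real_density D N f"
  shows "has_real_density (gamma_law a \<Otimes>\<^sub>M D) (log_lborel \<Otimes>\<^sub>M N) (\<lambda>p. gamma_log_density a (fst p) * f (snd p))"
proof -
  have sN [measurable_cong]: "sets N = sets borel" using N by (simp add: positive_space_def)
  have f: "f \<in> borel_measurable borel" "\<And>x. 0 \<le> f x" and D': "D = density N (\<lambda>x. ennreal (f x))"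
    and sD: "sigma_finite_measure D"
    using D by (auto simp: has_real_density_def)
  have eq: "gamma_law a \<Otimes>\<^sub>M D
      = density (log_lborel \<Otimes>\<^sub>M N) (\<lambda>p. ennreal (gamma_log_density a (fst p) * f (snd p)))"
    unfolding gamma_law_eq_density[OF assms(1)] D'
    using sD D' N f sigma_finite_log_lborel
    by (subst pair_measure_density)
       (auto simp: positive_space_def case_prod_beta' ennreal_mult gamma_log_density_nonneg assms(1))
  interpret D: sigma_finite_measure D by (rule sD)
  interpret g: prob_space "gamma_law a" by (rule prob_space_gamma_law) fact
  interpret pair_sigma_finite "gamma_law a" D ..
  have "sigma_finite_measure (gamma_law a \<Otimes>\<^sub>M D)" ..
  moreover have "(\<lambda>p. gamma_log_density a (fst p) * f (snd p)) \<in> borel_measurable borel"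
    using f(1) by (simp flip: borel_prod)
  ultimately show ?thesis
    using eq f(2) gamma_log_density_nonneg[OF assms(1)] by (simp add: has_real_density_def)
qed

text \<open>
  The densities of vectors of three, four and six independent gamma variables with respect to powers of
  \<^const>\<open>log_lborel\<close>.
\<close>

definition gamma_prod3 :: "real \<Rightarrow> real \<Rightarrow> real \<Rightarrow> real \<times> real \<times> real \<Rightarrow> real" where
  "gamma_prod3 a b c = (\<lambda>(x, y, z).
     exp (a * ln x + b * ln y + c * ln z - (x + y + z)) / (Gamma a * Gamma b * Gamma c))"

definition gamma_prod4 ::
  "real \<Rightarrow> real \<Rightarrow> real \<Rightarrow> real \<Rightarrow> real \<times> real \<times> real \<times> real \<Rightarrow> real" where
  "gamma_prod4 a b c d = (\<lambda>(x, y, z, w).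
     exp (a * ln x + b * ln y + c * ln z + d * ln w - (x + y + z + w)) / (Gamma a * Gamma b * Gamma c * Gamma d))"

definition gamma_prod6 :: "real \<Rightarrow> real \<Rightarrow> real \<Rightarrow> real \<Rightarrow> real \<Rightarrow> real \<Rightarrow>
    real \<times> real \<times> real \<times> real \<times> real \<times> real \<Rightarrow> real" where
  "gamma_prod6 a1 a2 a3 a4 a5 a6 = (\<lambda>(x1, x2, x3, x4, x5, x6).
     exp (a1 * ln x1 + a2 * ln x2 + a3 * ln x3 + a4 * ln x4 + a5 * ln x5 + a6 * ln x6
       - (x1 + x2 + x3 + x4 + x5 + x6)) / (Gamma a1 * Gamma a2 * Gamma a3 * Gamma a4 * Gamma a5 * Gamma a6))"

lemma gamma_prod_measurable:
  "gamma_prod3 a b c \<in> borel_measurable borel"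
  "gamma_prod4 a b c d \<in> borel_measurable borel"
  "gamma_prod6 a b c d e f \<in> borel_measurable borel"
  unfolding gamma_prod3_def gamma_prod4_def gamma_prod6_def by (simp_all flip: borel_prod)

lemma gamma_law_prod3:
  assumes "0 < a" "0 < b" "0 < c"
  shows "gamma_law a \<Otimes>\<^sub>M gamma_law b \<Otimes>\<^sub>M gamma_law c = density log_lborel3 (\<lambda>t. ennreal (gamma_prod3 a b c t))"
proof -
  have "gamma_prod3 a b c = (\<lambda>t. gamma_log_density a (fst t) *
      (gamma_log_density b (fst (snd t)) * gamma_log_density c (snd (snd t))))"
    by (simp add: gamma_prod3_def gamma_log_density_def exp_add exp_diff case_prod_beta' fun_eq_iff mult_ac)
  thus ?thesis
    using has_real_density_gamma_law_pair[OF assms(1) positive_space_log_lborel2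
      has_real_density_gamma_law_pair[OF assms(2) positive_space_log_lborel has_real_density_gamma_law[OF assms(3)]]]
    by (simp add: has_real_density_def)
qed

lemma gamma_law_prod4:
  assumes "0 < a" "0 < b" "0 < c" "0 < d"
  shows "gamma_law a \<Otimes>\<^sub>M gamma_law b \<Otimes>\<^sub>M gamma_law c \<Otimes>\<^sub>M gamma_law d
    = density log_lborel4 (\<lambda>t. ennreal (gamma_prod4 a b c d t))"
proof -
  have "gamma_prod4 a b c d = (\<lambda>t. gamma_log_density a (fst t) * (gamma_log_density b (fst (snd t)) *
      (gamma_log_density c (fst (snd (snd t))) * gamma_log_density d (snd (snd (snd t))))))"
    by (simp add: gamma_prod4_def gamma_log_density_def exp_add exp_diff case_prod_beta' fun_eq_iff mult_ac)
  thus ?thesis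
    using has_real_density_gamma_law_pair[OF assms(1) positive_space_log_lborel3
      has_real_density_gamma_law_pair[OF assms(2) positive_space_log_lborel2
      has_real_density_gamma_law_pair[OF assms(3) positive_space_log_lborel has_real_density_gamma_law[OF assms(4)]]]]
    by (simp add: has_real_density_def)
qed

lemma gamma_law_prod6:
  assumes "0 < a1" "0 < a2" "0 < a3" "0 < a4" "0 < a5" "0 < a6"
  shows "gamma_law a1 \<Otimes>\<^sub>M gamma_law a2 \<Otimes>\<^sub>M gamma_law a3 \<Otimes>\<^sub>M gamma_law a4 \<Otimes>\<^sub>M gamma_law a5 \<Otimes>\<^sub>M gamma_law a6
    = density log_lborel6 (\<lambda>t. ennreal (gamma_prod6 a1 a2 a3 a4 a5 a6 t))"
proof -
  have "gamma_prod6 a1 a2 a3 a4 a5 a6 = (\<lambda>t. gamma_log_density a1 (fst t) * (gamma_log_density a2 (fst (snd t)) *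
      (gamma_log_density a3 (fst (snd (snd t))) * (gamma_log_density a4 (fst (snd (snd (snd t)))) *
      (gamma_log_density a5 (fst (snd (snd (snd (snd t))))) * gamma_log_density a6 (snd (snd (snd (snd (snd t))))))))))"
    by (simp add: gamma_prod6_def gamma_log_density_def exp_add exp_diff case_prod_beta' fun_eq_iff mult_ac)
  thus ?thesis
    using has_real_density_gamma_law_pair[OF assms(1) positive_space_log_lborel5
      has_real_density_gamma_law_pair[OF assms(2) positive_space_log_lborel4
      has_real_density_gamma_law_pair[OF assms(3) positive_space_log_lborel3
      has_real_density_gamma_law_pair[OF assms(4) positive_space_log_lborel2
      has_real_density_gamma_law_pair[OF assms(5) positive_space_log_lborel has_real_density_gamma_law[OF assms(6)]]]]]]
    by (simp add: has_real_density_def)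
qed

section \<open>The changes of Lusztig parameters\<close>

lemma
  shows lusztig_A2_log_symmetry: "log_symmetry log_lborel3 orthant3 lusztig_A2"
    and gamma_prod3_lusztig_A2: "\<And>t. t \<in> orthant3 \<Longrightarrow>
      gamma_prod3 a1 (a1 + a2) a2 t
        = gamma_prod3 a2 (a1 + a2) a1 (lusztig_A2 t)"
proof -
  define t1 t2 t3 :: "real \<times> real \<times> real \<Rightarrow> real"
    where t_def: "t1 t = fst t" "t2 t = fst (snd t)" "t3 t = snd (snd t)" for t
  have pos: "0 < t1 t" "0 < t2 t" "0 < t3 t" if "t \<in> orthant3" for t
    using that by (auto simp: t_def)
  \<comment> \<open>The chamber variables of the word \<open>(1, 2, 1)\<close>; the one mutation turns \<open>A1\<close> into \<open>B1\<close>.\<close>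
  define A1 A2 A3 where A_def: "A1 t = 1 / t1 t" "A2 t = A1 t / t2 t" "A3 t = A2 t / A1 t / t3 t" for t
  define B1 where B1_def: "B1 t = (t1 t + t3 t) / (t2 t * t3 t)" for t
  define p1 p2 p3 where p_def: "p1 t = t2 t * t3 t / (t1 t + t3 t)" "p2 t = t1 t + t3 t"
    "p3 t = t1 t * t2 t / (t1 t + t3 t)" for t
  have B1: "B1 t = (A2 t + A3 t) / A1 t" if "t \<in> orthant3" for t
    using pos[OF that] by (simp add: A_def B1_def field_simps)
  \<comment> \<open>After the mutation, \<open>B1\<close>, \<open>A3\<close>, \<open>A2\<close> are the chamber variables of \<open>p\<close> for the word \<open>(2, 1, 2)\<close>, in this order.\<close>
  have p: "p3 t = A3 t / B1 t / A2 t" "p2 t = B1 t / A3 t" "p1 t = 1 / B1 t" if "t \<in> orthant3" for t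
    using pos[OF that] by (simp_all add: A_def B1_def p_def field_simps)
  have t: "t = (t1 t, t2 t, t3 t)" for t
    by (simp add: t_def)
  have lusztig: "lusztig_A2 t = (p1 t, p2 t, p3 t)" for t
    by (simp add: lusztig_A2_def p_def t_def case_prod_beta')
  have "log_symmetry log_lborel3 orthant3 (\<lambda>t. (t1 t, t2 t, t3 t))"
    by (rule log_symmetry_cong[OF log_symmetry_id]) (simp add: t_def)
  then have "log_symmetry log_lborel3 orthant3 (\<lambda>t. (A1 t, t2 t, t3 t))"
    by (rule log_symmetry_step[OF coord3_1, where c = "\<lambda>(x1, x2, x3). 1"])
       (auto simp: A_def add_pos_pos simp flip: borel_prod)
  then have "log_symmetry log_lborel3 orthant3 (\<lambda>t. (A1 t, A2 t, t3 t))"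
    by (rule log_symmetry_step[OF coord3_2, where c = "\<lambda>(x1, x2, x3). x1"])
       (auto simp: A_def add_pos_pos simp flip: borel_prod)
  then have "log_symmetry log_lborel3 orthant3 (\<lambda>t. (A1 t, A2 t, A3 t))"
    by (rule log_symmetry_step[OF coord3_3, where c = "\<lambda>(x1, x2, x3). x2 / x1"])
       (auto simp: A_def add_pos_pos simp flip: borel_prod)
  then have "log_symmetry log_lborel3 orthant3 (\<lambda>t. (B1 t, A2 t, A3 t))"
    by (rule log_symmetry_step[OF coord3_1, where c = "\<lambda>(x1, x2, x3). x2 + x3"])
       (auto simp: B1 add_pos_pos simp flip: borel_prod)
  then have "log_symmetry log_lborel3 orthant3 (\<lambda>t. (B1 t, p3 t, A3 t))"
    by (rule log_symmetry_step[OF coord3_2, where c = "\<lambda>(x1, x2, x3). x3 / x1"])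
       (auto simp: p add_pos_pos simp flip: borel_prod)
  then have "log_symmetry log_lborel3 orthant3 (\<lambda>t. (B1 t, p3 t, p2 t))"
    by (rule log_symmetry_step[OF coord3_3, where c = "\<lambda>(x1, x2, x3). x1"])
       (auto simp: p add_pos_pos simp flip: borel_prod)
  then have "log_symmetry log_lborel3 orthant3 (\<lambda>t. (p1 t, p3 t, p2 t))"
    by (rule log_symmetry_step[OF coord3_1, where c = "\<lambda>(x1, x2, x3). 1"])
       (auto simp: p add_pos_pos simp flip: borel_prod)
  from log_symmetry_swap[OF coord3_2 coord3_3 this]
  have "log_symmetry log_lborel3 orthant3 (\<lambda>t. (p1 t, p2 t, p3 t))" by simp
  then show "log_symmetry log_lborel3 orthant3 lusztig_A2"
    by (rule log_symmetry_cong) (simp add: lusztig)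
  have sum: "p1 t + p2 t + p3 t = t1 t + t2 t + t3 t" if "t \<in> orthant3" for t
  proof -
    have "t1 t + t3 t \<noteq> 0" using pos[OF that] by simp
    moreover have "p1 t + p3 t = (t1 t + t3 t) * t2 t / (t1 t + t3 t)"
      by (simp add: p_def algebra_simps add_divide_distrib)
    ultimately have "p1 t + p3 t = t2 t" by simp
    thus ?thesis by (simp add: p_def)
  qed
  have ln_p: "ln (p1 t) = ln (t2 t) + ln (t3 t) - ln (p2 t)" "ln (p3 t) = ln (t1 t) + ln (t2 t) - ln (p2 t)"
    if "t \<in> orthant3" for t
    using pos[OF that] by (simp_all add: p_def ln_div ln_mult)
  show "gamma_prod3 a1 (a1 + a2) a2 t
      = gamma_prod3 a2 (a1 + a2) a1 (lusztig_A2 t)" if "t \<in> orthant3" for t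
  proof -
    have monomials: "a2 * ln (p1 t) + (a1 + a2) * ln (p2 t) + a1 * ln (p3 t)
        = a1 * ln (t1 t) + (a1 + a2) * ln (t2 t) + a2 * ln (t3 t)"
      unfolding ln_p[OF that] by algebra
    show ?thesis
      unfolding lusztig
      by (subst t, simp only: gamma_prod3_def prod.case sum[OF that] monomials) (simp only: mult_ac)
  qed
qed

lemma
  shows lusztig_B2_log_symmetry: "log_symmetry log_lborel4 orthant4 lusztig_B2"
    and gamma_prod4_lusztig_B2: "\<And>t. t \<in> orthant4 \<Longrightarrow>
      gamma_prod4 a1 (a1 + a2) (a1 + 2 * a2) a2 t
        = gamma_prod4 a2 (a1 + 2 * a2) (a1 + a2) a1 (lusztig_B2 t)"
proof -
  define t1 t2 t3 t4 :: "real \<times> real \<times> real \<times> real \<Rightarrow> real"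
    where t_def: "t1 t = fst t" "t2 t = fst (snd t)" "t3 t = fst (snd (snd t))" "t4 t = snd (snd (snd t))" for t
  have pos: "0 < t1 t" "0 < t2 t" "0 < t3 t" "0 < t4 t" if "t \<in> orthant4" for t
    using that by (auto simp: t_def)
  define \<pi>1 \<pi>2 where \<pi>_def: "\<pi>1 t = t1 t * t2 t + (t1 t + t3 t) * t4 t"
    "\<pi>2 t = (t1 t)^2 * t2 t + (t1 t + t3 t)^2 * t4 t" for t
  have \<pi>_pos: "0 < \<pi>1 t" "0 < \<pi>2 t" if "t \<in> orthant4" for t
    using pos[OF that] by (simp_all add: \<pi>_def add_pos_pos)
  \<comment> \<open>The chamber variables of the word \<open>(1, 2, 1, 2)\<close>, mutated at positions \<open>1\<close>, \<open>2\<close>, \<open>1\<close> into \<open>B1\<close>, \<open>B2\<close>, \<open>C1\<close>.\<close>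
  define A1 A2 A3 A4 where A_def: "A1 t = 1 / t1 t" "A2 t = (A1 t)^2 / t2 t" "A3 t = A2 t / A1 t / t3 t"
    "A4 t = (A3 t)^2 / A2 t / t4 t" for t
  define U where U_def: "U t = t1 t + t3 t" for t
  define B1 B2 C1 where BC_def: "B1 t = U t / (t1 t * t2 t * t3 t)"
    "B2 t = \<pi>2 t / (t2 t * (t3 t)^2 * t4 t)" "C1 t = \<pi>1 t / (t2 t * (t3 t)^2 * t4 t)" for t
  define p1 p2 p3 p4 where p_def: "p1 t = t2 t * (t3 t)^2 * t4 t / \<pi>2 t" "p2 t = \<pi>2 t / \<pi>1 t"
    "p3 t = (\<pi>1 t)^2 / \<pi>2 t" "p4 t = t1 t * t2 t * t3 t / \<pi>1 t" for t
  have A_eq: "A1 t = 1 / t1 t" "A2 t = 1 / ((t1 t)^2 * t2 t)" "A3 t = 1 / (t1 t * t2 t * t3 t)"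
    "A4 t = 1 / (t2 t * (t3 t)^2 * t4 t)" if "t \<in> orthant4" for t
    using pos[OF that] by (simp_all add: A_def field_simps power2_eq_square)
  have U: "0 < U t" if "t \<in> orthant4" for t
    using pos[OF that] by (simp add: U_def)
  have exchange: "\<pi>2 t = (t1 t)^2 * t2 t + (U t)^2 * t4 t" "\<pi>1 t * U t = \<pi>2 t + t1 t * t2 t * t3 t" for t
    unfolding \<pi>_def U_def by algebra+
  have B1: "B1 t = (A2 t + A3 t) / A1 t" if "t \<in> orthant4" for t
    using pos[OF that] unfolding A_eq[OF that] BC_def U_def by (simp add: field_simps power2_eq_square)
  have B2: "B2 t = ((B1 t)^2 + A4 t) / A2 t" if "t \<in> orthant4" for t
    using pos[OF that] unfolding A_eq[OF that] BC_def exchange(1) by (simp add: field_simps power2_eq_square)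
  have C1: "C1 t = (B2 t * A3 t + A4 t) / B1 t" if "t \<in> orthant4" for t
    using pos[OF that] U[OF that] exchange(2)[of t] unfolding A_eq[OF that] BC_def
    by (simp add: field_simps power2_eq_square; algebra)
  \<comment> \<open>The chamber variables of \<open>p\<close> for the word \<open>(2, 1, 2, 1)\<close> are \<open>B2\<close>, \<open>C1\<close>, \<open>A4\<close>, \<open>A3\<close>, in this order.\<close>
  have p: "p4 t = A4 t / C1 t / A3 t" "p3 t = (C1 t)^2 / B2 t / A4 t" "p2 t = B2 t / C1 t" "p1 t = 1 / B2 t"
    if "t \<in> orthant4" for t
    using pos[OF that] \<pi>_pos[OF that] unfolding A_eq[OF that] BC_def p_def by (simp_all add: field_simps power2_eq_square)
  have t: "t = (t1 t, t2 t, t3 t, t4 t)" for t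
    by (simp add: t_def)
  have lusztig: "lusztig_B2 t = (p1 t, p2 t, p3 t, p4 t)" for t
    by (simp add: lusztig_B2_def Let_def p_def \<pi>_def t_def case_prod_beta')
  have "log_symmetry log_lborel4 orthant4 (\<lambda>t. (t1 t, t2 t, t3 t, t4 t))"
    by (rule log_symmetry_cong[OF log_symmetry_id]) (simp add: t_def)
  then have "log_symmetry log_lborel4 orthant4 (\<lambda>t. (A1 t, t2 t, t3 t, t4 t))"
    by (rule log_symmetry_step[OF coord4_1, where
         c = "\<lambda>(x1, x2, x3, x4). 1"])
       (auto simp: A_def add_pos_pos simp flip: borel_prod)
  then have "log_symmetry log_lborel4 orthant4 (\<lambda>t. (A1 t, A2 t, t3 t, t4 t))"
    by (rule log_symmetry_step[OF coord4_2, where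
         c = "\<lambda>(x1, x2, x3, x4). x1^2"])
       (auto simp: A_def add_pos_pos simp flip: borel_prod)
  then have "log_symmetry log_lborel4 orthant4 (\<lambda>t. (A1 t, A2 t, A3 t, t4 t))"
    by (rule log_symmetry_step[OF coord4_3, where
         c = "\<lambda>(x1, x2, x3, x4). x2 / x1"])
       (auto simp: A_def add_pos_pos simp flip: borel_prod)
  then have "log_symmetry log_lborel4 orthant4 (\<lambda>t. (A1 t, A2 t, A3 t, A4 t))"
    by (rule log_symmetry_step[OF coord4_4, where
         c = "\<lambda>(x1, x2, x3, x4). x3^2 / x2"])
       (auto simp: A_def add_pos_pos simp flip: borel_prod)
  then have "log_symmetry log_lborel4 orthant4 (\<lambda>t. (B1 t, A2 t, A3 t, A4 t))"
    by (rule log_symmetry_step[OF coord4_1, where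
         c = "\<lambda>(x1, x2, x3, x4). x2 + x3"])
       (auto simp: B1 add_pos_pos simp flip: borel_prod)
  then have "log_symmetry log_lborel4 orthant4 (\<lambda>t. (B1 t, B2 t, A3 t, A4 t))"
    by (rule log_symmetry_step[OF coord4_2, where
         c = "\<lambda>(x1, x2, x3, x4). x1^2 + x4"])
       (auto simp: B2 add_pos_pos simp flip: borel_prod)
  then have "log_symmetry log_lborel4 orthant4 (\<lambda>t. (C1 t, B2 t, A3 t, A4 t))"
    by (rule log_symmetry_step[OF coord4_1, where
         c = "\<lambda>(x1, x2, x3, x4). x2 * x3 + x4"])
       (auto simp: C1 add_pos_pos simp flip: borel_prod)
  then have "log_symmetry log_lborel4 orthant4 (\<lambda>t. (C1 t, B2 t, p4 t, A4 t))"
    by (rule log_symmetry_step[OF coord4_3, where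
         c = "\<lambda>(x1, x2, x3, x4). x4 / x1"])
       (auto simp: p add_pos_pos simp flip: borel_prod)
  then have "log_symmetry log_lborel4 orthant4 (\<lambda>t. (C1 t, B2 t, p4 t, p3 t))"
    by (rule log_symmetry_step[OF coord4_4, where
         c = "\<lambda>(x1, x2, x3, x4). x1^2 / x2"])
       (auto simp: p add_pos_pos simp flip: borel_prod)
  then have "log_symmetry log_lborel4 orthant4 (\<lambda>t. (p2 t, B2 t, p4 t, p3 t))"
    by (rule log_symmetry_step[OF coord4_1, where
         c = "\<lambda>(x1, x2, x3, x4). x2"])
       (auto simp: p add_pos_pos simp flip: borel_prod)
  then have "log_symmetry log_lborel4 orthant4 (\<lambda>t. (p2 t, p1 t, p4 t, p3 t))"
    by (rule log_symmetry_step[OF coord4_2, where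
         c = "\<lambda>(x1, x2, x3, x4). 1"])
       (auto simp: p add_pos_pos simp flip: borel_prod)
  from log_symmetry_swap[OF coord4_1 coord4_2 this]
  have "log_symmetry log_lborel4 orthant4 (\<lambda>t. (p1 t, p2 t, p4 t, p3 t))" by simp
  from log_symmetry_swap[OF coord4_3 coord4_4 this]
  have "log_symmetry log_lborel4 orthant4 (\<lambda>t. (p1 t, p2 t, p3 t, p4 t))" by simp
  then show "log_symmetry log_lborel4 orthant4 lusztig_B2"
    by (rule log_symmetry_cong) (simp add: lusztig)
  have sum: "p1 t + p2 t + p3 t + p4 t = t1 t + t2 t + t3 t + t4 t" if "t \<in> orthant4" for t
  proof -
    have "t2 t * (t3 t)^2 * t4 t + (\<pi>1 t)^2 = (t2 t + t4 t) * \<pi>2 t" unfolding \<pi>_def by algebra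
    hence "p1 t + p3 t = t2 t + t4 t" using \<pi>_pos[OF that] by (simp add: p_def field_simps)
    moreover have "\<pi>2 t + t1 t * t2 t * t3 t = (t1 t + t3 t) * \<pi>1 t" unfolding \<pi>_def by algebra
    hence "p2 t + p4 t = t1 t + t3 t" using \<pi>_pos[OF that] by (simp add: p_def field_simps)
    ultimately show ?thesis by simp
  qed
  have ln_p: "ln (p1 t) = ln (t2 t) + 2 * ln (t3 t) + ln (t4 t) - ln (\<pi>2 t)" "ln (p2 t) = ln (\<pi>2 t) - ln (\<pi>1 t)"
    "ln (p3 t) = 2 * ln (\<pi>1 t) - ln (\<pi>2 t)" "ln (p4 t) = ln (t1 t) + ln (t2 t) + ln (t3 t) - ln (\<pi>1 t)"
    if "t \<in> orthant4" for t
    using pos[OF that] \<pi>_pos[OF that] by (simp_all add: p_def ln_div ln_mult ln_realpow)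
  show "gamma_prod4 a1 (a1 + a2) (a1 + 2 * a2) a2 t
      = gamma_prod4 a2 (a1 + 2 * a2) (a1 + a2) a1 (lusztig_B2 t)" if "t \<in> orthant4" for t
  proof -
    have monomials: "a2 * ln (p1 t) + (a1 + 2 * a2) * ln (p2 t) + (a1 + a2) * ln (p3 t) + a1 * ln (p4 t)
        = a1 * ln (t1 t) + (a1 + a2) * ln (t2 t) + (a1 + 2 * a2) * ln (t3 t) + a2 * ln (t4 t)"
      unfolding ln_p[OF that] by algebra
    show ?thesis
      unfolding lusztig
      by (subst t, simp only: gamma_prod4_def prod.case sum[OF that] monomials) (simp only: mult_ac)
  qed
qed

lemma
  shows lusztig_C2_log_symmetry: "log_symmetry log_lborel4 orthant4 lusztig_C2"
    and gamma_prod4_lusztig_C2: "\<And>t. t \<in> orthant4 \<Longrightarrow>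
      gamma_prod4 a1 (2 * a1 + a2) (a1 + a2) a2 t
        = gamma_prod4 a2 (a1 + a2) (2 * a1 + a2) a1 (lusztig_C2 t)"
proof -
  define t1 t2 t3 t4 :: "real \<times> real \<times> real \<times> real \<Rightarrow> real"
    where t_def: "t1 t = fst t" "t2 t = fst (snd t)" "t3 t = fst (snd (snd t))" "t4 t = snd (snd (snd t))" for t
  have pos: "0 < t1 t" "0 < t2 t" "0 < t3 t" "0 < t4 t" if "t \<in> orthant4" for t
    using that by (auto simp: t_def)
  define \<pi>1 \<pi>2 where \<pi>_def: "\<pi>1 t = t1 t * t2 t + (t1 t + t3 t) * t4 t"
    "\<pi>2 t = t3 t * (t4 t)^2 + (t2 t + t4 t)^2 * t1 t" for t
  have \<pi>_pos: "0 < \<pi>1 t" "0 < \<pi>2 t" if "t \<in> orthant4" for t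
    using pos[OF that] by (simp_all add: \<pi>_def add_pos_pos)
  \<comment> \<open>The chamber variables of the word \<open>(1, 2, 1, 2)\<close>, mutated at positions \<open>1\<close>, \<open>2\<close>, \<open>1\<close> into \<open>B1\<close>, \<open>B2\<close>, \<open>C1\<close>.\<close>
  define A1 A2 A3 A4 where A_def: "A1 t = 1 / t1 t" "A2 t = A1 t / t2 t" "A3 t = (A2 t)^2 / A1 t / t3 t"
    "A4 t = A3 t / A2 t / t4 t" for t
  define U where U_def: "U t = t1 t + t3 t" for t
  define B1 B2 C1 where BC_def: "B1 t = U t / (t1 t * (t2 t)^2 * t3 t)"
    "B2 t = \<pi>1 t / (t2 t * t3 t * t4 t)" "C1 t = \<pi>2 t / (t2 t * t3 t * t4 t)^2" for t
  define p1 p2 p3 p4 where p_def: "p1 t = t2 t * t3 t * t4 t / \<pi>1 t" "p2 t = (\<pi>1 t)^2 / \<pi>2 t"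
    "p3 t = \<pi>2 t / \<pi>1 t" "p4 t = t1 t * (t2 t)^2 * t3 t / \<pi>2 t" for t
  have A_eq: "A1 t = 1 / t1 t" "A2 t = 1 / (t1 t * t2 t)" "A3 t = 1 / (t1 t * (t2 t)^2 * t3 t)"
    "A4 t = 1 / (t2 t * t3 t * t4 t)" if "t \<in> orthant4" for t
    using pos[OF that] by (simp_all add: A_def field_simps power2_eq_square)
  have U: "0 < U t" if "t \<in> orthant4" for t
    using pos[OF that] by (simp add: U_def)
  have exchange: "\<pi>1 t = t1 t * t2 t + U t * t4 t" "\<pi>2 t * U t = (\<pi>1 t)^2 + t1 t * (t2 t)^2 * t3 t" for t
    unfolding \<pi>_def U_def by algebra+
  have B1: "B1 t = ((A2 t)^2 + A3 t) / A1 t" if "t \<in> orthant4" for t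
    using pos[OF that] unfolding A_eq[OF that] BC_def U_def by (simp add: field_simps power2_eq_square)
  have B2: "B2 t = (B1 t + A4 t) / A2 t" if "t \<in> orthant4" for t
    using pos[OF that] unfolding A_eq[OF that] BC_def exchange(1) by (simp add: field_simps power2_eq_square)
  have C1: "C1 t = ((B2 t)^2 * A3 t + (A4 t)^2) / B1 t" if "t \<in> orthant4" for t
    using pos[OF that] U[OF that] exchange(2)[of t] unfolding A_eq[OF that] BC_def
    by (simp add: field_simps power2_eq_square; algebra)
  \<comment> \<open>The chamber variables of \<open>p\<close> for the word \<open>(2, 1, 2, 1)\<close> are \<open>B2\<close>, \<open>C1\<close>, \<open>A4\<close>, \<open>A3\<close>, in this order.\<close>
  have p: "p4 t = (A4 t)^2 / C1 t / A3 t" "p3 t = C1 t / B2 t / A4 t" "p2 t = (B2 t)^2 / C1 t" "p1 t = 1 / B2 t"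
    if "t \<in> orthant4" for t
    using pos[OF that] \<pi>_pos[OF that] unfolding A_eq[OF that] BC_def p_def by (simp_all add: field_simps power2_eq_square)
  have t: "t = (t1 t, t2 t, t3 t, t4 t)" for t
    by (simp add: t_def)
  have lusztig: "lusztig_C2 t = (p1 t, p2 t, p3 t, p4 t)" for t
    by (simp add: lusztig_C2_def Let_def p_def \<pi>_def t_def case_prod_beta')
  have "log_symmetry log_lborel4 orthant4 (\<lambda>t. (t1 t, t2 t, t3 t, t4 t))"
    by (rule log_symmetry_cong[OF log_symmetry_id]) (simp add: t_def)
  then have "log_symmetry log_lborel4 orthant4 (\<lambda>t. (A1 t, t2 t, t3 t, t4 t))"
    by (rule log_symmetry_step[OF coord4_1, where
         c = "\<lambda>(x1, x2, x3, x4). 1"])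
       (auto simp: A_def add_pos_pos simp flip: borel_prod)
  then have "log_symmetry log_lborel4 orthant4 (\<lambda>t. (A1 t, A2 t, t3 t, t4 t))"
    by (rule log_symmetry_step[OF coord4_2, where
         c = "\<lambda>(x1, x2, x3, x4). x1"])
       (auto simp: A_def add_pos_pos simp flip: borel_prod)
  then have "log_symmetry log_lborel4 orthant4 (\<lambda>t. (A1 t, A2 t, A3 t, t4 t))"
    by (rule log_symmetry_step[OF coord4_3, where
         c = "\<lambda>(x1, x2, x3, x4). x2^2 / x1"])
       (auto simp: A_def add_pos_pos simp flip: borel_prod)
  then have "log_symmetry log_lborel4 orthant4 (\<lambda>t. (A1 t, A2 t, A3 t, A4 t))"
    by (rule log_symmetry_step[OF coord4_4, where
         c = "\<lambda>(x1, x2, x3, x4). x3 / x2"])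
       (auto simp: A_def add_pos_pos simp flip: borel_prod)
  then have "log_symmetry log_lborel4 orthant4 (\<lambda>t. (B1 t, A2 t, A3 t, A4 t))"
    by (rule log_symmetry_step[OF coord4_1, where
         c = "\<lambda>(x1, x2, x3, x4). x2^2 + x3"])
       (auto simp: B1 add_pos_pos simp flip: borel_prod)
  then have "log_symmetry log_lborel4 orthant4 (\<lambda>t. (B1 t, B2 t, A3 t, A4 t))"
    by (rule log_symmetry_step[OF coord4_2, where
         c = "\<lambda>(x1, x2, x3, x4). x1 + x4"])
       (auto simp: B2 add_pos_pos simp flip: borel_prod)
  then have "log_symmetry log_lborel4 orthant4 (\<lambda>t. (C1 t, B2 t, A3 t, A4 t))"
    by (rule log_symmetry_step[OF coord4_1, where
         c = "\<lambda>(x1, x2, x3, x4). x2^2 * x3 + x4^2"])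
       (auto simp: C1 add_pos_pos simp flip: borel_prod)
  then have "log_symmetry log_lborel4 orthant4 (\<lambda>t. (C1 t, B2 t, p4 t, A4 t))"
    by (rule log_symmetry_step[OF coord4_3, where
         c = "\<lambda>(x1, x2, x3, x4). x4^2 / x1"])
       (auto simp: p add_pos_pos simp flip: borel_prod)
  then have "log_symmetry log_lborel4 orthant4 (\<lambda>t. (C1 t, B2 t, p4 t, p3 t))"
    by (rule log_symmetry_step[OF coord4_4, where
         c = "\<lambda>(x1, x2, x3, x4). x1 / x2"])
       (auto simp: p add_pos_pos simp flip: borel_prod)
  then have "log_symmetry log_lborel4 orthant4 (\<lambda>t. (p2 t, B2 t, p4 t, p3 t))"
    by (rule log_symmetry_step[OF coord4_1, where
         c = "\<lambda>(x1, x2, x3, x4). x2^2"])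
       (auto simp: p add_pos_pos simp flip: borel_prod)
  then have "log_symmetry log_lborel4 orthant4 (\<lambda>t. (p2 t, p1 t, p4 t, p3 t))"
    by (rule log_symmetry_step[OF coord4_2, where
         c = "\<lambda>(x1, x2, x3, x4). 1"])
       (auto simp: p add_pos_pos simp flip: borel_prod)
  from log_symmetry_swap[OF coord4_1 coord4_2 this]
  have "log_symmetry log_lborel4 orthant4 (\<lambda>t. (p1 t, p2 t, p4 t, p3 t))" by simp
  from log_symmetry_swap[OF coord4_3 coord4_4 this]
  have "log_symmetry log_lborel4 orthant4 (\<lambda>t. (p1 t, p2 t, p3 t, p4 t))" by simp
  then show "log_symmetry log_lborel4 orthant4 lusztig_C2"
    by (rule log_symmetry_cong) (simp add: lusztig)
  have sum: "p1 t + p2 t + p3 t + p4 t = t1 t + t2 t + t3 t + t4 t" if "t \<in> orthant4" for t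
  proof -
    have "t2 t * t3 t * t4 t + \<pi>2 t = (t2 t + t4 t) * \<pi>1 t" unfolding \<pi>_def by algebra
    hence "p1 t + p3 t = t2 t + t4 t" using \<pi>_pos[OF that] by (simp add: p_def field_simps)
    moreover have "(\<pi>1 t)^2 + t1 t * (t2 t)^2 * t3 t = (t1 t + t3 t) * \<pi>2 t" unfolding \<pi>_def by algebra
    hence "p2 t + p4 t = t1 t + t3 t" using \<pi>_pos[OF that] by (simp add: p_def field_simps)
    ultimately show ?thesis by simp
  qed
  have ln_p: "ln (p1 t) = ln (t2 t) + ln (t3 t) + ln (t4 t) - ln (\<pi>1 t)" "ln (p2 t) = 2 * ln (\<pi>1 t) - ln (\<pi>2 t)"
    "ln (p3 t) = ln (\<pi>2 t) - ln (\<pi>1 t)" "ln (p4 t) = ln (t1 t) + 2 * ln (t2 t) + ln (t3 t) - ln (\<pi>2 t)"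
    if "t \<in> orthant4" for t
    using pos[OF that] \<pi>_pos[OF that] by (simp_all add: p_def ln_div ln_mult ln_realpow)
  show "gamma_prod4 a1 (2 * a1 + a2) (a1 + a2) a2 t
      = gamma_prod4 a2 (a1 + a2) (2 * a1 + a2) a1 (lusztig_C2 t)" if "t \<in> orthant4" for t
  proof -
    have monomials: "a2 * ln (p1 t) + (a1 + a2) * ln (p2 t) + (2 * a1 + a2) * ln (p3 t) + a1 * ln (p4 t)
        = a1 * ln (t1 t) + (2 * a1 + a2) * ln (t2 t) + (a1 + a2) * ln (t3 t) + a2 * ln (t4 t)"
      unfolding ln_p[OF that] by algebra
    show ?thesis
      unfolding lusztig
      by (subst t, simp only: gamma_prod4_def prod.case sum[OF that] monomials) (simp only: mult_ac)
  qed
qed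

lemma
  shows lusztig_G2_log_symmetry: "log_symmetry log_lborel6 orthant6 lusztig_G2"
    and gamma_prod6_lusztig_G2: "\<And>t. t \<in> orthant6 \<Longrightarrow>
      gamma_prod6 a1 (a1 + a2) (2 * a1 + 3 * a2) (a1 + 2 * a2) (a1 + 3 * a2) a2 t
        = gamma_prod6 a2 (a1 + 3 * a2) (a1 + 2 * a2) (2 * a1 + 3 * a2) (a1 + a2) a1 (lusztig_G2 t)"
proof -
  define t1 t2 t3 t4 t5 t6 :: "real \<times> real \<times> real \<times> real \<times> real \<times> real \<Rightarrow> real"
    where t_def: "t1 t = fst t" "t2 t = fst (snd t)" "t3 t = fst (snd (snd t))"
      "t4 t = fst (snd (snd (snd t)))" "t5 t = fst (snd (snd (snd (snd t))))"
      "t6 t = snd (snd (snd (snd (snd t))))" for t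
  have pos: "0 < t1 t" "0 < t2 t" "0 < t3 t" "0 < t4 t" "0 < t5 t" "0 < t6 t" if "t \<in> orthant6" for t
    using that by (auto simp: t_def)
  define \<pi>1 where \<pi>1_def: "\<pi>1 t = t1 t * t2 t * (t3 t)^2 * t4 t + t1 t * t2 t * (t3 t + t5 t)^2 * t6 t
      + (t1 t + t3 t) * t4 t * (t5 t)^2 * t6 t" for t
  define \<pi>2 where \<pi>2_def: "\<pi>2 t = (t1 t)^2 * (t2 t)^2 * (t3 t)^3 * t4 t + (t1 t)^2 * (t2 t)^2 * (t3 t + t5 t)^3 * t6 t
      + (t1 t + t3 t)^2 * (t4 t)^2 * (t5 t)^3 * t6 t
      + t1 t * t2 t * t4 t * (t5 t)^2 * t6 t * (3 * t1 t * t3 t + 2 * (t3 t)^2 + 2 * t3 t * t5 t + 2 * t1 t * t5 t)" for t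
  define \<pi>3 where \<pi>3_def: "\<pi>3 t = (t1 t)^3 * (t2 t)^2 * (t3 t)^3 * t4 t + (t1 t)^3 * (t2 t)^2 * (t3 t + t5 t)^3 * t6 t
      + (t1 t + t3 t)^3 * (t4 t)^2 * (t5 t)^3 * t6 t
      + (t1 t)^2 * t2 t * t4 t * (t5 t)^2 * t6 t * (3 * t1 t * t3 t + 3 * (t3 t)^2 + 3 * t3 t * t5 t + 2 * t1 t * t5 t)" for t
  define \<pi>4 where \<pi>4_def: "\<pi>4 t = (t1 t)^2 * (t2 t)^2 * (t3 t)^3 * t4 t *
        (t1 t * t2 t * (t3 t)^3 * t4 t + 2 * t1 t * t2 t * (t3 t + t5 t)^3 * t6 t
         + (3 * t1 t * t3 t + 3 * (t3 t)^2 + 3 * t3 t * t5 t + 2 * t1 t * t5 t) * t4 t * (t5 t)^2 * t6 t)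
      + (t6 t)^2 * (t1 t * t2 t * (t3 t + t5 t)^2 + (t1 t + t3 t) * t4 t * (t5 t)^2)^3" for t
  \<comment> \<open>Numerators of the cluster variables between the initial and the final cluster.\<close>
  define T where T_def: "T t = t1 t + t3 t + t5 t" for t
  define U where U_def: "U t = t1 t + t3 t" for t
  define P where P_def: "P t = (t1 t)^3 * t2 t + (t1 t + t3 t)^3 * t4 t" for t
  define S where S_def: "S t = (t1 t)^2 * t2 t * (t3 t + t5 t) + (t1 t + t3 t)^2 * t4 t * t5 t" for t
  define Q where Q_def: "Q t = (t1 t)^3 * t2 t + (t1 t + t3 t)^3 * t4 t + (t1 t + t3 t + t5 t)^3 * t6 t" for t
  define R where R_def: "R t = (t1 t + t3 t) * (t1 t * t2 t * (t3 t)^2 * t4 t)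
      + (t1 t + t3 t + t5 t) * t6 t * (t1 t * t2 t * (t3 t + t5 t)^2 + (t1 t + t3 t) * t4 t * (t5 t)^2)" for t
  have \<pi>_pos: "0 < \<pi>1 t" "0 < \<pi>2 t" "0 < \<pi>3 t" "0 < \<pi>4 t" if "t \<in> orthant6" for t
    using pos[OF that] by (simp_all add: \<pi>1_def \<pi>2_def \<pi>3_def \<pi>4_def add_pos_pos)
  have poly_pos: "0 < T t" "0 < U t" "0 < P t" "0 < S t" "0 < Q t" "0 < R t" if "t \<in> orthant6" for t
    using pos[OF that] by (simp_all add: T_def U_def P_def S_def Q_def R_def add_pos_pos)
  \<comment> \<open>Six of the ten exchange relations, with denominators cleared.\<close>
  have exchange:
    "U t * S t = P t * t5 t + T t * ((t1 t)^2 * t2 t * t3 t)"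
    "\<pi>3 t * P t = (S t)^3 * t6 t + Q t * ((t1 t)^3 * (t2 t)^2 * (t3 t)^3 * t4 t)"
    "R t * S t = \<pi>3 t * T t + Q t * (t1 t * t2 t * (t3 t)^2 * t4 t * t5 t)"
    "\<pi>1 t * T t = R t + t1 t * t2 t * (t3 t)^2 * t4 t * t5 t"
    "\<pi>4 t * Q t = (R t)^3 + (\<pi>3 t)^2"
    "\<pi>2 t * R t = \<pi>3 t * \<pi>1 t + \<pi>4 t" for t
    subgoal unfolding U_def T_def S_def P_def by algebra
    subgoal unfolding S_def P_def \<pi>3_def Q_def by algebra
    subgoal unfolding T_def S_def R_def \<pi>3_def Q_def by algebra
    subgoal unfolding T_def \<pi>1_def R_def by algebra
    subgoal unfolding \<pi>4_def R_def \<pi>3_def Q_def by algebra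
    subgoal unfolding \<pi>4_def R_def \<pi>3_def \<pi>2_def \<pi>1_def by algebra
    done
  \<comment> \<open>Denominators; \<open>M1\<close> and \<open>M2\<close> are the two monomials preserved by the map.\<close>
  define K M1 M2 where K_def: "K t = (t1 t)^3 * (t2 t)^2 * (t3 t)^3 * t4 t"
    and M1_def: "M1 t = t1 t * t2 t * (t3 t)^2 * t4 t * t5 t"
    and M2_def: "M2 t = t2 t * (t3 t)^3 * (t4 t)^2 * (t5 t)^3 * t6 t" for t
  have M_pos: "0 < K t" "0 < M1 t" "0 < M2 t" if "t \<in> orthant6" for t
    using pos[OF that] by (simp_all add: K_def M1_def M2_def)
  \<comment> \<open>The chamber variables of the word \<open>(1, 2, 1, 2, 1, 2)\<close>.\<close>
  define A1 A2 A3 A4 A5 A6 where A_def: "A1 t = 1 / t1 t" "A2 t = (A1 t)^3 / t2 t" "A3 t = A2 t / A1 t / t3 t"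
    "A4 t = (A3 t)^3 / A2 t / t4 t" "A5 t = A4 t / A3 t / t5 t" "A6 t = (A5 t)^3 / A4 t / t6 t" for t
  have A_eq: "A1 t = 1 / t1 t" "A2 t = 1 / ((t1 t)^3 * t2 t)" "A3 t = 1 / ((t1 t)^2 * t2 t * t3 t)"
    "A4 t = 1 / K t" "A5 t = 1 / M1 t" "A6 t = 1 / M2 t" if "t \<in> orthant6" for t
    using pos[OF that] by (simp_all add: A_def K_def M1_def M2_def field_simps power2_eq_square power3_eq_cube)
  \<comment> \<open>The mutations at positions \<open>1\<close>, \<open>3\<close>, \<open>2\<close>, \<open>1\<close>, \<open>4\<close>, \<open>2\<close>, \<open>1\<close>, \<open>3\<close>, \<open>4\<close>, \<open>1\<close> produce
    \<open>B1\<close>, \<open>B3\<close>, \<open>B2\<close>, \<open>C1\<close>, \<open>B4\<close>, \<open>C2\<close>, \<open>D1\<close>, \<open>D3\<close>, \<open>D4\<close>, \<open>E1\<close>, in this order.\<close>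
  define B1 B2 B3 B4 C1 C2 D1 D3 D4 E1 where B1_def: "B1 t = U t / ((t1 t)^2 * t2 t * t3 t)"
    and B2_def: "B2 t = P t / K t" and B3_def: "B3 t = T t / M1 t" and B4_def: "B4 t = Q t / M2 t"
    and C1_def: "C1 t = S t / M1 t" and C2_def: "C2 t = \<pi>3 t / M2 t" and D1_def: "D1 t = R t / M2 t"
    and D3_def: "D3 t = \<pi>1 t / M2 t" and D4_def: "D4 t = \<pi>4 t / (M2 t)^2" and E1_def: "E1 t = \<pi>2 t / M2 t" for t
  define p1 p2 p3 p4 p5 p6 where p_def: "p1 t = M2 t / \<pi>3 t" "p2 t = \<pi>3 t / \<pi>2 t"
    "p3 t = (\<pi>2 t)^3 / (\<pi>3 t * \<pi>4 t)" "p4 t = \<pi>4 t / (\<pi>1 t * \<pi>2 t)"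
    "p5 t = (\<pi>1 t)^3 / \<pi>4 t" "p6 t = M1 t / \<pi>1 t" for t
  have B1: "B1 t = (A2 t + A3 t) / A1 t" if "t \<in> orthant6" for t
    using pos[OF that] unfolding A_eq[OF that] B1_def U_def
    by (simp add: field_simps power2_eq_square power3_eq_cube)
  have B3: "B3 t = (B1 t * A5 t + A4 t) / A3 t" if "t \<in> orthant6" for t
    using pos[OF that] unfolding A_eq[OF that] B1_def B3_def U_def T_def K_def M1_def
    by (simp add: field_simps power2_eq_square power3_eq_cube)
  have B2: "B2 t = ((B1 t)^3 + A4 t) / A2 t" if "t \<in> orthant6" for t
    using pos[OF that] unfolding A_eq[OF that] B1_def B2_def U_def P_def K_def
    by (simp add: field_simps power2_eq_square power3_eq_cube)
  have C1: "C1 t = (B2 t + B3 t) / B1 t" if "t \<in> orthant6" for t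
  proof -
    have "K t * t5 t = M1 t * ((t1 t)^2 * t2 t * t3 t)" by (simp add: K_def M1_def power2_eq_square power3_eq_cube)
    hence "C1 t * B1 t = B2 t + B3 t"
      using pos[OF that] M_pos[OF that] exchange(1)[of t]
      unfolding B1_def B2_def B3_def C1_def by (simp add: field_simps; algebra)
    thus ?thesis using poly_pos[OF that] pos[OF that] by (simp add: B1_def field_simps)
  qed
  have B4: "B4 t = (B2 t * A6 t + (B3 t)^3) / A4 t" if "t \<in> orthant6" for t
  proof -
    have "(M1 t)^3 * t6 t = K t * M2 t" by (simp add: K_def M1_def M2_def power2_eq_square power3_eq_cube)
    moreover have "Q t = P t + (T t)^3 * t6 t" by (simp add: Q_def P_def T_def)
    ultimately show ?thesis
      using pos[OF that] M_pos[OF that]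
      unfolding A_eq[OF that] B2_def B3_def B4_def by (simp add: field_simps; algebra)
  qed
  have C2: "C2 t = ((C1 t)^3 + B4 t) / B2 t" if "t \<in> orthant6" for t
  proof -
    have "(M1 t)^3 * t6 t = K t * M2 t" by (simp add: K_def M1_def M2_def power2_eq_square power3_eq_cube)
    thus ?thesis
      using pos[OF that] M_pos[OF that] poly_pos[OF that] exchange(2)[of t, folded K_def]
      unfolding B2_def B4_def C1_def C2_def by (simp add: field_simps; algebra)
  qed
  have D1: "D1 t = (C2 t * B3 t + B4 t) / C1 t" if "t \<in> orthant6" for t
    using M_pos[OF that] poly_pos[OF that] exchange(3)[of t, folded M1_def]
    unfolding B3_def B4_def C1_def C2_def D1_def by (simp add: field_simps)
  have D3: "D3 t = (D1 t * A5 t + A6 t) / B3 t" if "t \<in> orthant6" for t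
    using M_pos[OF that] poly_pos[OF that] exchange(4)[of t, folded M1_def]
    unfolding A_eq[OF that] B3_def D1_def D3_def by (simp add: field_simps)
  have D4: "D4 t = ((D1 t)^3 + (C2 t)^2 * A6 t) / B4 t" if "t \<in> orthant6" for t
    using M_pos[OF that] poly_pos[OF that] exchange(5)[of t]
    unfolding A_eq[OF that] B4_def C2_def D1_def D4_def by (simp add: field_simps power2_eq_square power3_eq_cube)
  have E1: "E1 t = (C2 t * D3 t + D4 t) / D1 t" if "t \<in> orthant6" for t
    using M_pos[OF that] poly_pos[OF that] exchange(6)[of t]
    unfolding C2_def D1_def D3_def D4_def E1_def by (simp add: field_simps power2_eq_square)
  \<comment> \<open>The chamber variables of \<open>p\<close> for the word \<open>(2, 1, 2, 1, 2, 1)\<close> are \<open>C2\<close>, \<open>E1\<close>, \<open>D4\<close>, \<open>D3\<close>, \<open>A6\<close>, \<open>A5\<close>, in this order.\<close>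
  have p: "p6 t = A6 t / D3 t / A5 t" "p5 t = (D3 t)^3 / D4 t / A6 t" "p4 t = D4 t / E1 t / D3 t"
    "p3 t = (E1 t)^3 / C2 t / D4 t" "p2 t = C2 t / E1 t" "p1 t = 1 / C2 t" if "t \<in> orthant6" for t
    using M_pos[OF that] \<pi>_pos[OF that] unfolding A_eq[OF that] C2_def D3_def D4_def E1_def p_def
    by (simp_all add: field_simps power2_eq_square power3_eq_cube)
  have t: "t = (t1 t, t2 t, t3 t, t4 t, t5 t, t6 t)" for t
    by (simp add: t_def)
  have lusztig: "lusztig_G2 t = (p1 t, p2 t, p3 t, p4 t, p5 t, p6 t)" for t
    by (simp add: lusztig_G2_def Let_def p_def M1_def M2_def \<pi>1_def \<pi>2_def \<pi>3_def \<pi>4_def t_def case_prod_beta')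
  have "log_symmetry log_lborel6 orthant6 (\<lambda>t. (t1 t, t2 t, t3 t, t4 t, t5 t, t6 t))"
    by (rule log_symmetry_cong[OF log_symmetry_id]) (simp add: t_def)
  then have "log_symmetry log_lborel6 orthant6 (\<lambda>t. (A1 t, t2 t, t3 t, t4 t, t5 t, t6 t))"
    by (rule log_symmetry_step[OF coord6_1, where
         c = "\<lambda>(x1, x2, x3, x4, x5, x6). 1"])
       (auto simp: A_def add_pos_pos simp flip: borel_prod)
  then have "log_symmetry log_lborel6 orthant6 (\<lambda>t. (A1 t, A2 t, t3 t, t4 t, t5 t, t6 t))"
    by (rule log_symmetry_step[OF coord6_2, where
         c = "\<lambda>(x1, x2, x3, x4, x5, x6). x1^3"])
       (auto simp: A_def add_pos_pos simp flip: borel_prod)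
  then have "log_symmetry log_lborel6 orthant6 (\<lambda>t. (A1 t, A2 t, A3 t, t4 t, t5 t, t6 t))"
    by (rule log_symmetry_step[OF coord6_3, where
         c = "\<lambda>(x1, x2, x3, x4, x5, x6). x2 / x1"])
       (auto simp: A_def add_pos_pos simp flip: borel_prod)
  then have "log_symmetry log_lborel6 orthant6 (\<lambda>t. (A1 t, A2 t, A3 t, A4 t, t5 t, t6 t))"
    by (rule log_symmetry_step[OF coord6_4, where
         c = "\<lambda>(x1, x2, x3, x4, x5, x6). x3^3 / x2"])
       (auto simp: A_def add_pos_pos simp flip: borel_prod)
  then have "log_symmetry log_lborel6 orthant6 (\<lambda>t. (A1 t, A2 t, A3 t, A4 t, A5 t, t6 t))"
    by (rule log_symmetry_step[OF coord6_5, where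
         c = "\<lambda>(x1, x2, x3, x4, x5, x6). x4 / x3"])
       (auto simp: A_def add_pos_pos simp flip: borel_prod)
  then have "log_symmetry log_lborel6 orthant6 (\<lambda>t. (A1 t, A2 t, A3 t, A4 t, A5 t, A6 t))"
    by (rule log_symmetry_step[OF coord6_6, where
         c = "\<lambda>(x1, x2, x3, x4, x5, x6). x5^3 / x4"])
       (auto simp: A_def add_pos_pos simp flip: borel_prod)
  then have "log_symmetry log_lborel6 orthant6 (\<lambda>t. (B1 t, A2 t, A3 t, A4 t, A5 t, A6 t))"
    by (rule log_symmetry_step[OF coord6_1, where
         c = "\<lambda>(x1, x2, x3, x4, x5, x6). x2 + x3"])
       (auto simp: B1 add_pos_pos simp flip: borel_prod)
  then have "log_symmetry log_lborel6 orthant6 (\<lambda>t. (B1 t, A2 t, B3 t, A4 t, A5 t, A6 t))"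
    by (rule log_symmetry_step[OF coord6_3, where
         c = "\<lambda>(x1, x2, x3, x4, x5, x6). x1 * x5 + x4"])
       (auto simp: B3 add_pos_pos simp flip: borel_prod)
  then have "log_symmetry log_lborel6 orthant6 (\<lambda>t. (B1 t, B2 t, B3 t, A4 t, A5 t, A6 t))"
    by (rule log_symmetry_step[OF coord6_2, where
         c = "\<lambda>(x1, x2, x3, x4, x5, x6). x1^3 + x4"])
       (auto simp: B2 add_pos_pos simp flip: borel_prod)
  then have "log_symmetry log_lborel6 orthant6 (\<lambda>t. (C1 t, B2 t, B3 t, A4 t, A5 t, A6 t))"
    by (rule log_symmetry_step[OF coord6_1, where
         c = "\<lambda>(x1, x2, x3, x4, x5, x6). x2 + x3"])
       (auto simp: C1 add_pos_pos simp flip: borel_prod)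
  then have "log_symmetry log_lborel6 orthant6 (\<lambda>t. (C1 t, B2 t, B3 t, B4 t, A5 t, A6 t))"
    by (rule log_symmetry_step[OF coord6_4, where
         c = "\<lambda>(x1, x2, x3, x4, x5, x6). x2 * x6 + x3^3"])
       (auto simp: B4 add_pos_pos simp flip: borel_prod)
  then have "log_symmetry log_lborel6 orthant6 (\<lambda>t. (C1 t, C2 t, B3 t, B4 t, A5 t, A6 t))"
    by (rule log_symmetry_step[OF coord6_2, where
         c = "\<lambda>(x1, x2, x3, x4, x5, x6). x1^3 + x4"])
       (auto simp: C2 add_pos_pos simp flip: borel_prod)
  then have "log_symmetry log_lborel6 orthant6 (\<lambda>t. (D1 t, C2 t, B3 t, B4 t, A5 t, A6 t))"
    by (rule log_symmetry_step[OF coord6_1, where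
         c = "\<lambda>(x1, x2, x3, x4, x5, x6). x2 * x3 + x4"])
       (auto simp: D1 add_pos_pos simp flip: borel_prod)
  then have "log_symmetry log_lborel6 orthant6 (\<lambda>t. (D1 t, C2 t, D3 t, B4 t, A5 t, A6 t))"
    by (rule log_symmetry_step[OF coord6_3, where
         c = "\<lambda>(x1, x2, x3, x4, x5, x6). x1 * x5 + x6"])
       (auto simp: D3 add_pos_pos simp flip: borel_prod)
  then have "log_symmetry log_lborel6 orthant6 (\<lambda>t. (D1 t, C2 t, D3 t, D4 t, A5 t, A6 t))"
    by (rule log_symmetry_step[OF coord6_4, where
         c = "\<lambda>(x1, x2, x3, x4, x5, x6). x1^3 + x2^2 * x6"])
       (auto simp: D4 add_pos_pos simp flip: borel_prod)
  then have "log_symmetry log_lborel6 orthant6 (\<lambda>t. (E1 t, C2 t, D3 t, D4 t, A5 t, A6 t))"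
    by (rule log_symmetry_step[OF coord6_1, where
         c = "\<lambda>(x1, x2, x3, x4, x5, x6). x2 * x3 + x4"])
       (auto simp: E1 add_pos_pos simp flip: borel_prod)
  then have "log_symmetry log_lborel6 orthant6 (\<lambda>t. (E1 t, C2 t, D3 t, D4 t, p6 t, A6 t))"
    by (rule log_symmetry_step[OF coord6_5, where
         c = "\<lambda>(x1, x2, x3, x4, x5, x6). x6 / x3"])
       (auto simp: p add_pos_pos simp flip: borel_prod)
  then have "log_symmetry log_lborel6 orthant6 (\<lambda>t. (E1 t, C2 t, D3 t, D4 t, p6 t, p5 t))"
    by (rule log_symmetry_step[OF coord6_6, where
         c = "\<lambda>(x1, x2, x3, x4, x5, x6). x3^3 / x4"])
       (auto simp: p add_pos_pos simp flip: borel_prod)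
  then have "log_symmetry log_lborel6 orthant6 (\<lambda>t. (E1 t, C2 t, p4 t, D4 t, p6 t, p5 t))"
    by (rule log_symmetry_step[OF coord6_3, where
         c = "\<lambda>(x1, x2, x3, x4, x5, x6). x4 / x1"])
       (auto simp: p add_pos_pos simp flip: borel_prod)
  then have "log_symmetry log_lborel6 orthant6 (\<lambda>t. (E1 t, C2 t, p4 t, p3 t, p6 t, p5 t))"
    by (rule log_symmetry_step[OF coord6_4, where
         c = "\<lambda>(x1, x2, x3, x4, x5, x6). x1^3 / x2"])
       (auto simp: p add_pos_pos simp flip: borel_prod)
  then have "log_symmetry log_lborel6 orthant6 (\<lambda>t. (p2 t, C2 t, p4 t, p3 t, p6 t, p5 t))"
    by (rule log_symmetry_step[OF coord6_1, where
         c = "\<lambda>(x1, x2, x3, x4, x5, x6). x2"])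
       (auto simp: p add_pos_pos simp flip: borel_prod)
  then have "log_symmetry log_lborel6 orthant6 (\<lambda>t. (p2 t, p1 t, p4 t, p3 t, p6 t, p5 t))"
    by (rule log_symmetry_step[OF coord6_2, where
         c = "\<lambda>(x1, x2, x3, x4, x5, x6). 1"])
       (auto simp: p add_pos_pos simp flip: borel_prod)
  from log_symmetry_swap[OF coord6_1 coord6_2 this]
  have "log_symmetry log_lborel6 orthant6 (\<lambda>t. (p1 t, p2 t, p4 t, p3 t, p6 t, p5 t))" by simp
  from log_symmetry_swap[OF coord6_3 coord6_4 this]
  have "log_symmetry log_lborel6 orthant6 (\<lambda>t. (p1 t, p2 t, p3 t, p4 t, p6 t, p5 t))" by simp
  from log_symmetry_swap[OF coord6_5 coord6_6 this]
  have "log_symmetry log_lborel6 orthant6 (\<lambda>t. (p1 t, p2 t, p3 t, p4 t, p5 t, p6 t))" by simp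
  then show "log_symmetry log_lborel6 orthant6 lusztig_G2"
    by (rule log_symmetry_cong) (simp add: lusztig)
  have sum: "p1 t + p2 t + p3 t + p4 t + p5 t + p6 t = t1 t + t2 t + t3 t + t4 t + t5 t + t6 t" if "t \<in> orthant6" for t
  proof -
    have "M2 t * \<pi>4 t + (\<pi>2 t)^3 + (\<pi>1 t)^3 * \<pi>3 t = (t2 t + t4 t + t6 t) * (\<pi>3 t * \<pi>4 t)"
      unfolding M2_def \<pi>1_def \<pi>2_def \<pi>3_def \<pi>4_def by algebra
    hence "p1 t + p3 t + p5 t = t2 t + t4 t + t6 t"
      using \<pi>_pos[OF that] by (simp add: p_def field_simps)
    moreover have "\<pi>1 t * \<pi>3 t + \<pi>4 t + M1 t * \<pi>2 t = (t1 t + t3 t + t5 t) * (\<pi>1 t * \<pi>2 t)"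
      unfolding M1_def \<pi>1_def \<pi>2_def \<pi>3_def \<pi>4_def by algebra
    hence "p2 t + p4 t + p6 t = t1 t + t3 t + t5 t"
      using \<pi>_pos[OF that] by (simp add: p_def field_simps)
    ultimately show ?thesis by simp
  qed
  have ln_p: "ln (p1 t) = ln (t2 t) + 3 * ln (t3 t) + 2 * ln (t4 t) + 3 * ln (t5 t) + ln (t6 t) - ln (\<pi>3 t)"
    "ln (p2 t) = ln (\<pi>3 t) - ln (\<pi>2 t)" "ln (p3 t) = 3 * ln (\<pi>2 t) - ln (\<pi>3 t) - ln (\<pi>4 t)"
    "ln (p4 t) = ln (\<pi>4 t) - ln (\<pi>1 t) - ln (\<pi>2 t)" "ln (p5 t) = 3 * ln (\<pi>1 t) - ln (\<pi>4 t)"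
    "ln (p6 t) = ln (t1 t) + ln (t2 t) + 2 * ln (t3 t) + ln (t4 t) + ln (t5 t) - ln (\<pi>1 t)"
    if "t \<in> orthant6" for t
    using pos[OF that] \<pi>_pos[OF that] by (simp_all add: p_def M1_def M2_def ln_div ln_mult ln_realpow)
  show "gamma_prod6 a1 (a1 + a2) (2 * a1 + 3 * a2) (a1 + 2 * a2) (a1 + 3 * a2) a2 t
      = gamma_prod6 a2 (a1 + 3 * a2) (a1 + 2 * a2) (2 * a1 + 3 * a2) (a1 + a2) a1 (lusztig_G2 t)" if "t \<in> orthant6" for t
  proof -
    have monomials: "a2 * ln (p1 t) + (a1 + 3 * a2) * ln (p2 t) + (a1 + 2 * a2) * ln (p3 t) + (2 * a1 + 3 * a2) * ln (p4 t) + (a1 + a2) * ln (p5 t) + a1 * ln (p6 t)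
        = a1 * ln (t1 t) + (a1 + a2) * ln (t2 t) + (2 * a1 + 3 * a2) * ln (t3 t) + (a1 + 2 * a2) * ln (t4 t) + (a1 + 3 * a2) * ln (t5 t) + a2 * ln (t6 t)"
      unfolding ln_p[OF that] by algebra
    show ?thesis
      unfolding lusztig
      by (subst t, simp only: gamma_prod6_def prod.case sum[OF that] monomials) (simp only: mult_ac)
  qed
qed

section \<open>The identities in law\<close>

lemma lusztig_measurable:
  "lusztig_A2 \<in> borel_measurable borel" "lusztig_B2 \<in> borel_measurable borel"
  "lusztig_C2 \<in> borel_measurable borel" "lusztig_G2 \<in> borel_measurable borel"
  unfolding lusztig_A2_def lusztig_B2_def lusztig_C2_def lusztig_G2_def Let_def by (simp_all flip: borel_prod)

theorem theorem2p21:
  fixes M :: "'a measure" and a1 a2 :: real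
  assumes "prob_space M" and "0 < a1" and "0 < a2"
  shows
   "(\<forall>t1 t2 t3. pos_rv M t1 \<and> pos_rv M t2 \<and> pos_rv M t3 \<longrightarrow>
       (distr M borel (\<lambda>\<omega>. (t1 \<omega>, t2 \<omega>, t3 \<omega>))
          = gamma_law a1 \<Otimes>\<^sub>M gamma_law (a1 + a2) \<Otimes>\<^sub>M gamma_law a2
        \<longleftrightarrow>
        distr M borel (\<lambda>\<omega>. lusztig_A2 (t1 \<omega>, t2 \<omega>, t3 \<omega>))
          = gamma_law a2 \<Otimes>\<^sub>M gamma_law (a1 + a2) \<Otimes>\<^sub>M gamma_law a1))
    \<and>
    (\<forall>t1 t2 t3 t4. pos_rv M t1 \<and> pos_rv M t2 \<and> pos_rv M t3 \<and> pos_rv M t4 \<longrightarrow>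
       (distr M borel (\<lambda>\<omega>. (t1 \<omega>, t2 \<omega>, t3 \<omega>, t4 \<omega>))
          = gamma_law a1 \<Otimes>\<^sub>M gamma_law (a1 + a2) \<Otimes>\<^sub>M gamma_law (a1 + 2 * a2) \<Otimes>\<^sub>M gamma_law a2
        \<longleftrightarrow>
        distr M borel (\<lambda>\<omega>. lusztig_B2 (t1 \<omega>, t2 \<omega>, t3 \<omega>, t4 \<omega>))
          = gamma_law a2 \<Otimes>\<^sub>M gamma_law (a1 + 2 * a2) \<Otimes>\<^sub>M gamma_law (a1 + a2) \<Otimes>\<^sub>M gamma_law a1))
    \<and>
    (\<forall>t1 t2 t3 t4. pos_rv M t1 \<and> pos_rv M t2 \<and> pos_rv M t3 \<and> pos_rv M t4 \<longrightarrow>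
       (distr M borel (\<lambda>\<omega>. (t1 \<omega>, t2 \<omega>, t3 \<omega>, t4 \<omega>))
          = gamma_law a1 \<Otimes>\<^sub>M gamma_law (2 * a1 + a2) \<Otimes>\<^sub>M gamma_law (a1 + a2) \<Otimes>\<^sub>M gamma_law a2
        \<longleftrightarrow>
        distr M borel (\<lambda>\<omega>. lusztig_C2 (t1 \<omega>, t2 \<omega>, t3 \<omega>, t4 \<omega>))
          = gamma_law a2 \<Otimes>\<^sub>M gamma_law (a1 + a2) \<Otimes>\<^sub>M gamma_law (2 * a1 + a2) \<Otimes>\<^sub>M gamma_law a1))
    \<and>
    (\<forall>t1 t2 t3 t4 t5 t6. pos_rv M t1 \<and> pos_rv M t2 \<and> pos_rv M t3
                       \<and> pos_rv M t4 \<and> pos_rv M t5 \<and> pos_rv M t6 \<longrightarrow>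
       (distr M borel (\<lambda>\<omega>. (t1 \<omega>, t2 \<omega>, t3 \<omega>, t4 \<omega>, t5 \<omega>, t6 \<omega>))
          = gamma_law a1 \<Otimes>\<^sub>M gamma_law (a1 + a2) \<Otimes>\<^sub>M gamma_law (2 * a1 + 3 * a2)
            \<Otimes>\<^sub>M gamma_law (a1 + 2 * a2) \<Otimes>\<^sub>M gamma_law (a1 + 3 * a2) \<Otimes>\<^sub>M gamma_law a2
        \<longleftrightarrow>
        distr M borel (\<lambda>\<omega>. lusztig_G2 (t1 \<omega>, t2 \<omega>, t3 \<omega>, t4 \<omega>, t5 \<omega>, t6 \<omega>))
          = gamma_law a2 \<Otimes>\<^sub>M gamma_law (a1 + 3 * a2) \<Otimes>\<^sub>M gamma_law (a1 + 2 * a2)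
            \<Otimes>\<^sub>M gamma_law (2 * a1 + 3 * a2) \<Otimes>\<^sub>M gamma_law (a1 + a2) \<Otimes>\<^sub>M gamma_law a1))"
proof (intro conjI allI impI, goal_cases)
  case (1 t1 t2 t3)
  have "(\<lambda>\<omega>. (t1 \<omega>, t2 \<omega>, t3 \<omega>)) \<in> borel_measurable M" "AE \<omega> in M. (t1 \<omega>, t2 \<omega>, t3 \<omega>) \<in> orthant3"
    using 1 by (auto simp: pos_rv_def simp flip: borel_prod)
  thus ?case
    using assms(2,3) gamma_prod_measurable(1) gamma_prod3_lusztig_A2[of _ a1 a2]
    by (intro law_iff_of_log_symmetry[OF positive_space_log_lborel3 lusztig_A2_log_symmetry lusztig_measurable(1) _ _
          gamma_law_prod3 gamma_law_prod3]) auto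
next
  case (2 t1 t2 t3 t4)
  have "(\<lambda>\<omega>. (t1 \<omega>, t2 \<omega>, t3 \<omega>, t4 \<omega>)) \<in> borel_measurable M"
    "AE \<omega> in M. (t1 \<omega>, t2 \<omega>, t3 \<omega>, t4 \<omega>) \<in> orthant4"
    using 2 by (auto simp: pos_rv_def simp flip: borel_prod)
  thus ?case
    using assms(2,3) gamma_prod_measurable(2) gamma_prod4_lusztig_B2[of _ a1 a2]
    by (intro law_iff_of_log_symmetry[OF positive_space_log_lborel4 lusztig_B2_log_symmetry lusztig_measurable(2) _ _
          gamma_law_prod4 gamma_law_prod4]) auto
next
  case (3 t1 t2 t3 t4)
  have "(\<lambda>\<omega>. (t1 \<omega>, t2 \<omega>, t3 \<omega>, t4 \<omega>)) \<in> borel_measurable M"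
    "AE \<omega> in M. (t1 \<omega>, t2 \<omega>, t3 \<omega>, t4 \<omega>) \<in> orthant4"
    using 3 by (auto simp: pos_rv_def simp flip: borel_prod)
  thus ?case
    using assms(2,3) gamma_prod_measurable(2) gamma_prod4_lusztig_C2[of _ a1 a2]
    by (intro law_iff_of_log_symmetry[OF positive_space_log_lborel4 lusztig_C2_log_symmetry lusztig_measurable(3) _ _
          gamma_law_prod4 gamma_law_prod4]) auto
next
  case (4 t1 t2 t3 t4 t5 t6)
  have "(\<lambda>\<omega>. (t1 \<omega>, t2 \<omega>, t3 \<omega>, t4 \<omega>, t5 \<omega>, t6 \<omega>)) \<in> borel_measurable M"
    "AE \<omega> in M. (t1 \<omega>, t2 \<omega>, t3 \<omega>, t4 \<omega>, t5 \<omega>, t6 \<omega>) \<in> orthant6"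
    using 4 by (auto simp: pos_rv_def simp flip: borel_prod)
  thus ?case
    using assms(2,3) gamma_prod_measurable(3) gamma_prod6_lusztig_G2[of _ a1 a2]
    by (intro law_iff_of_log_symmetry[OF positive_space_log_lborel6 lusztig_G2_log_symmetry lusztig_measurable(4) _ _
          gamma_law_prod6 gamma_law_prod6]) auto
qed

end
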